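(* Let $\alpha=\{\alpha_1,\ldots,\alpha_n\}\subset\mathbb Z[x]^m$ be such that the $m\times n$ matrix with $i$-th column $\alpha_i$ has rank $m$ (i.e. $\alpha$ is Laurent transformally essential), and let $X_\alpha\subset\mathbb A^n$ be the toric $\sigma$-variety over $\mathbb Q$ defined by $\alpha$. Let $M_i=\mathbb T^{\alpha_i}$, let $\mathbf u_i=(u_{i0},\ldots,u_{in})$, $i=0,\ldots,m$, be families of $\sigma$-indeterminates, and put $$\mathbb P_i=u_{i0}+u_{i1}M_1+\cdots+u_{in}M_n,\qquad \mathbb L_i=u_{i0}+u_{i1}y_1+\cdots+u_{in}y_n\qquad(i=0,\ldots,m).$$ Then, up to a sign, the sparse $\sigma$-resultant $R_\alpha\in\mathbb Q\{\mathbf u_0,\ldots,\mathbf u_m\}$ of $\mathbb P_0,\ldots,\mathbb P_m$ is the same as the $\sigma$-Chow form $C_\alpha\in\mathbb Q\{\mathbf u_0,\ldots,\mathbf u_m\}$ of $X_\alpha$ with respect to the generic hyperplanes $\mathbb L_0,\ldots,\mathbb L_m$.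
   Context: $\mathbb Q$ is a difference field with $\sigma=\mathrm{id}$. $\mathbb T=(t_1,\ldots,t_m)$ and $\mathbb Y=\{y_1,\ldots,y_n\}$ are $\sigma$-indeterminates; for $p=\sum_ic_ix^i\in\mathbb Z[x]$, $a^p=\prod_i\sigma^i(a)^{c_i}$, and $\mathbb T^{\beta}=\prod_jt_j^{\beta_j}$ for $\beta\in\mathbb Z[x]^m$. $\mathbb Q\{\cdot\}$ denotes difference polynomial rings and $\{\mathbb T^\pm\}$ Laurent difference polynomials. $[S]$ is the $\sigma$-ideal (ideal closed under $\sigma$) generated by $S$. The toric $\sigma$-variety $X_\alpha$ is the zero set (over all $\sigma$-field extensions of $\mathbb Q$) of the reflexive prime $\sigma$-ideal $\mathcal I_\alpha=\{f\in\mathbb Q\{\mathbb Y\}\mid f(\mathbb T^{\alpha_1},\ldots,\mathbb T^{\alpha_n})=0\}$; its dimension is the rank of the matrix $[\alpha_1,\ldots,\alpha_n]$, here $m$. Sparse $\sigma$-resultant: under the rank assumption, $[\mathbb P_0,\ldots,\mathbb P_m]\cap\mathbb Q\{\mathbf u_0,\ldots,\mathbf u_m\}$ (the $\sigma$-ideal being generated in $\mathbb Q\{\mathbf u_0,\ldots,\mathbf u_m,\mathbb T^\pm\}$) is a reflexive prime $\sigma$-ideal of codimension one, of the form $\mathrm{sat}(R_\alpha,R_1,\ldots,R_l)$ with $R_\alpha,R_1,\ldots,R_l$ a characteristic set; $R_\alpha$ is the irreducible $\sigma$-polynomial (normalized to be a primitive integer polynomial, unique up to sign) which can serve as the first polynomial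 of a characteristic set of this ideal with respect to any ranking, and it is called the sparse $\sigma$-resultant. $\sigma$-Chow form: $[\mathcal I_\alpha,\mathbb L_0,\ldots,\mathbb L_m]\cap\mathbb Q\{\mathbf u_0,\ldots,\mathbf u_m\}$ (generated in $\mathbb Q\{\mathbb Y,\mathbf u_0,\ldots,\mathbf u_m\}$) is a reflexive prime $\sigma$-ideal of codimension one, of the form $\mathrm{sat}(C_\alpha,C_1,\ldots,C_t)$ with $C_\alpha,C_1,\ldots,C_t$ a characteristic set; $C_\alpha$, the irreducible first polynomial of such a characteristic set with the same normalization, is the $\sigma$-Chow form. Here a characteristic set of a $\sigma$-ideal is an ascending chain (w.r.t. a ranking) in the ideal such that the ideal contains no nonzero element reduced w.r.t. it, and $\mathrm{sat}(\mathcal A)$ consists of all $p$ with $hp\in[\mathcal A]$ for some product $h$ of transforms of initials of $\mathcal A$. *)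

theory Defs
  imports
    "HOL-Analysis.Analysis"
    "HOL-Computational_Algebra.Computational_Algebra"
    "HOL-Library.Poly_Mapping"
begin

section \<open>Difference polynomials\<close>

text \<open>
  The pair \<open>(v, k)\<close> stands for the transform \<open>\<sigma>\<^sup>k(v)\<close> of the indeterminate \<open>v\<close>.
  Taking \<open>('u, rat) dpoly\<close> as the coefficient type turns the types below into
  \<open>\<rat>{U}{Y} = \<rat>{U, Y}\<close> and \<open>\<rat>{U}{T\<^sup>\<plusminus>} = \<rat>{U, T\<^sup>\<plusminus>}\<close>.
\<close>

type_synonym ('v, 'a) dpoly = "('v \<times> nat \<Rightarrow>\<^sub>0 nat) \<Rightarrow>\<^sub>0 'a"
type_synonym ('v, 'a) laurent_dpoly = "('v \<times> nat \<Rightarrow>\<^sub>0 int) \<Rightarrow>\<^sub>0 'a"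

abbreviation dconst :: "'a \<Rightarrow> ('v \<times> nat \<Rightarrow>\<^sub>0 'e::comm_monoid_add) \<Rightarrow>\<^sub>0 'a::zero" where
  "dconst c \<equiv> Poly_Mapping.single 0 c"

definition dvar :: "'v \<Rightarrow> ('v, 'a::comm_ring_1) dpoly" where
  "dvar v = Poly_Mapping.single (Poly_Mapping.single (v, 0) 1) 1"

definition shift_exp :: "('v \<times> nat \<Rightarrow>\<^sub>0 'e::comm_monoid_add) \<Rightarrow> ('v \<times> nat \<Rightarrow>\<^sub>0 'e)" where
  "shift_exp e =
    (\<Sum>(v, k)\<in>Poly_Mapping.keys e. Poly_Mapping.single (v, Suc k) (Poly_Mapping.lookup e (v, k)))"

text \<open>The operator \<open>\<sigma>\<close> extending the endomorphism \<open>s\<close> of the coefficient ring.\<close>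

definition dshift ::
  "('a::comm_ring_1 \<Rightarrow> 'a) \<Rightarrow> (('v \<times> nat \<Rightarrow>\<^sub>0 'e::comm_monoid_add) \<Rightarrow>\<^sub>0 'a)
    \<Rightarrow> (('v \<times> nat \<Rightarrow>\<^sub>0 'e) \<Rightarrow>\<^sub>0 'a)" where
  "dshift s f =
    (\<Sum>e\<in>Poly_Mapping.keys f. Poly_Mapping.single (shift_exp e) (s (Poly_Mapping.lookup f e)))"

text \<open>
  The value of \<open>f\<close> at \<open>g\<close> in a ring with endomorphism \<open>s\<close>, the coefficients being embedded by \<open>c\<close>.
\<close>

definition deval ::
  "('b::comm_ring_1 \<Rightarrow> 'b) \<Rightarrow> ('a::zero \<Rightarrow> 'b) \<Rightarrow> ('v \<Rightarrow> 'b) \<Rightarrow> ('v, 'a) dpoly \<Rightarrow> 'b" where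
  "deval s c g f =
    (\<Sum>e\<in>Poly_Mapping.keys f. c (Poly_Mapping.lookup f e) *
      (\<Prod>(v, k)\<in>Poly_Mapping.keys e. ((s ^^ k) (g v)) ^ Poly_Mapping.lookup e (v, k)))"

definition is_sigma_ideal :: "('a::comm_ring_1 \<Rightarrow> 'a) \<Rightarrow> 'a set \<Rightarrow> bool" where
  "is_sigma_ideal s I \<longleftrightarrow>
    0 \<in> I \<and> (\<forall>a\<in>I. \<forall>b\<in>I. a + b \<in> I) \<and> (\<forall>r. \<forall>a\<in>I. r * a \<in> I) \<and> s ` I \<subseteq> I"

definition sigma_ideal :: "('a::comm_ring_1 \<Rightarrow> 'a) \<Rightarrow> 'a set \<Rightarrow> 'a set" where
  "sigma_ideal s S = \<Inter>{I. is_sigma_ideal s I \<and> S \<subseteq> I}"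


section \<open>Characteristic sets over \<open>\<rat>\<close>\<close>

definition ranking :: "('v \<times> nat) rel \<Rightarrow> bool" where
  "ranking r \<longleftrightarrow> strict_linear_order r \<and>
    (\<forall>v k. ((v, k), (v, Suc k)) \<in> r) \<and>
    (\<forall>v k w l. ((v, k), (w, l)) \<in> r \<longrightarrow> ((v, Suc k), (w, Suc l)) \<in> r)"

definition dvars :: "('v, rat) dpoly \<Rightarrow> ('v \<times> nat) set" where
  "dvars f = (\<Union>e\<in>Poly_Mapping.keys f. Poly_Mapping.keys e)"

definition deg_in :: "('v, rat) dpoly \<Rightarrow> 'v \<times> nat \<Rightarrow> nat" where
  "deg_in f x = Max (insert 0 ((\<lambda>e. Poly_Mapping.lookup e x) ` Poly_Mapping.keys f))"

definition leader :: "('v \<times> nat) rel \<Rightarrow> ('v, rat) dpoly \<Rightarrow> 'v \<times> nat" where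
  "leader r f = (THE x. x \<in> dvars f \<and> (\<forall>y\<in>dvars f. y \<noteq> x \<longrightarrow> (y, x) \<in> r))"

text \<open>For constant \<open>f\<close> the leader is unspecified, but the initial is \<open>f\<close> itself.\<close>

definition initial :: "('v \<times> nat) rel \<Rightarrow> ('v, rat) dpoly \<Rightarrow> ('v, rat) dpoly" where
  "initial r f =
    (\<Sum>e | e \<in> Poly_Mapping.keys f \<and> Poly_Mapping.lookup e (leader r f) = deg_in f (leader r f).
      Poly_Mapping.single (Poly_Mapping.update (leader r f) 0 e) (Poly_Mapping.lookup f e))"

definition lower_rank :: "('v \<times> nat) rel \<Rightarrow> ('v, rat) dpoly \<Rightarrow> ('v, rat) dpoly \<Rightarrow> bool" where
  "lower_rank r f g \<longleftrightarrow> dvars g \<noteq> {} \<and>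
    (dvars f = {} \<or> (leader r f, leader r g) \<in> r \<or>
      leader r f = leader r g \<and> deg_in f (leader r g) < deg_in g (leader r g))"

text \<open>No polynomial is reduced with respect to a constant.\<close>

definition reduced :: "('v \<times> nat) rel \<Rightarrow> ('v, rat) dpoly \<Rightarrow> ('v, rat) dpoly \<Rightarrow> bool" where
  "reduced r f a \<longleftrightarrow> dvars a \<noteq> {} \<and>
    (case leader r a of (v, k) \<Rightarrow> \<forall>l. deg_in f (v, k + l) < deg_in a (v, k))"

definition ascending_chain :: "('v \<times> nat) rel \<Rightarrow> ('v, rat) dpoly list \<Rightarrow> bool" where
  "ascending_chain r A \<longleftrightarrow> 0 \<notin> set A \<and>
    (\<forall>i j. i < j \<and> j < length A \<longrightarrow> lower_rank r (A ! i) (A ! j) \<and> reduced r (A ! j) (A ! i))"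

definition characteristic_set ::
  "('v \<times> nat) rel \<Rightarrow> ('v, rat) dpoly set \<Rightarrow> ('v, rat) dpoly list \<Rightarrow> bool" where
  "characteristic_set r I A \<longleftrightarrow> ascending_chain r A \<and> set A \<subseteq> I \<and>
    \<not> (\<exists>f\<in>I. f \<noteq> 0 \<and> (\<forall>a\<in>set A. reduced r f a))"

definition sat :: "('v \<times> nat) rel \<Rightarrow> ('v, rat) dpoly list \<Rightarrow> ('v, rat) dpoly set" where
  "sat r A = {p. \<exists>hs. snd ` set hs \<subseteq> set A \<and>
    (\<Prod>(k, a)\<leftarrow>hs. (dshift id ^^ k) (initial r a)) * p \<in> sigma_ideal (dshift id) (set A)}"

definition heads_characteristic_set ::
  "('v \<times> nat) rel \<Rightarrow> ('v, rat) dpoly set \<Rightarrow> ('v, rat) dpoly \<Rightarrow> bool" where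
  "heads_characteristic_set r I f \<longleftrightarrow>
    (\<exists>A. characteristic_set r I (f # A) \<and> I = sat r (f # A))"

definition primitive_integral :: "('v, rat) dpoly \<Rightarrow> bool" where
  "primitive_integral f \<longleftrightarrow> (\<forall>e. Poly_Mapping.lookup f e \<in> \<int>) \<and>
    Gcd ((\<lambda>e. \<lfloor>Poly_Mapping.lookup f e\<rfloor>) ` Poly_Mapping.keys f) = 1"


section \<open>Sparse difference resultants and difference Chow forms\<close>

text \<open>
  In the types below \<open>'n\<close> indexes \<open>y\<^sub>1, \<dots>, y\<^sub>n\<close> and \<open>'m\<close> indexes \<open>t\<^sub>1, \<dots>, t\<^sub>m\<close>.
  The \<open>m + 1\<close> families \<open>u\<^sub>0, \<dots>, u\<^sub>m\<close> are indexed by \<open>'m option\<close>, and the \<open>n + 1\<close>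
  members of each family by \<open>'n option\<close>, with \<open>None\<close> in place of the index \<open>0\<close>.
\<close>

type_synonym ('m, 'n) upoly = "('m option \<times> 'n option, rat) dpoly"

definition t_monomial :: "int poly ^ 'm \<Rightarrow> ('m::finite, 'a::comm_ring_1) laurent_dpoly" where
  "t_monomial \<beta> = (\<Prod>j\<in>UNIV. \<Prod>k\<le>Polynomial.degree (\<beta> $ j).
    Poly_Mapping.single (Poly_Mapping.single (j, k) (Polynomial.coeff (\<beta> $ j) k)) 1)"

definition toric_ideal :: "('n::finite \<Rightarrow> int poly ^ 'm::finite) \<Rightarrow> ('n, rat) dpoly set" where
  "toric_ideal \<alpha> = {f. deval (dshift id) dconst (\<lambda>i. t_monomial (\<alpha> i)) f = 0}"

definition sparse_P ::
  "('n::finite \<Rightarrow> int poly ^ 'm::finite) \<Rightarrow> 'm option \<Rightarrow> ('m, ('m, 'n) upoly) laurent_dpoly" where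
  "sparse_P \<alpha> i =
    dconst (dvar (i, None)) + (\<Sum>j\<in>UNIV. dconst (dvar (i, Some j)) * t_monomial (\<alpha> j))"

definition generic_hyperplane :: "'m option \<Rightarrow> ('n::finite, ('m::finite, 'n) upoly) dpoly" where
  "generic_hyperplane i =
    dconst (dvar (i, None)) + (\<Sum>j\<in>UNIV. dconst (dvar (i, Some j)) * dvar j)"

definition resultant_ideal ::
  "('n::finite \<Rightarrow> int poly ^ 'm::finite) \<Rightarrow> ('m, 'n) upoly set" where
  "resultant_ideal \<alpha> =
    {f. dconst f \<in> sigma_ideal (dshift (dshift id)) (range (sparse_P \<alpha>))}"

definition chow_ideal :: "('n::finite, rat) dpoly set \<Rightarrow> ('m::finite, 'n) upoly set" where
  "chow_ideal I =
    {f. dconst f \<in> sigma_ideal (dshift (dshift id))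
          (Poly_Mapping.map dconst ` I \<union> range generic_hyperplane)}"

definition is_sparse_resultant ::
  "('n::finite \<Rightarrow> int poly ^ 'm::finite) \<Rightarrow> ('m, 'n) upoly \<Rightarrow> bool" where
  "is_sparse_resultant \<alpha> R \<longleftrightarrow> irreducible R \<and> primitive_integral R \<and>
    (\<forall>r. ranking r \<longrightarrow> heads_characteristic_set r (resultant_ideal \<alpha>) R)"

text \<open>
  The Chow form of the variety with vanishing ideal \<open>I\<close> with respect to \<open>m + 1\<close> generic hyperplanes.
\<close>

definition is_chow_form :: "('n::finite, rat) dpoly set \<Rightarrow> ('m::finite, 'n) upoly \<Rightarrow> bool" where
  "is_chow_form I C \<longleftrightarrow> irreducible C \<and> primitive_integral C \<and>
    (\<exists>r. ranking r \<and> heads_characteristic_set r (chow_ideal I) C)"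

end

theory Submission
  imports Defs
begin

text \<open>
  Two facts give the theorem: the two elimination ideals in \<open>\<rat>{U}\<close> are equal, and an
  irreducible polynomial heading a characteristic set of an ideal is determined by the ideal and
  the ranking up to a constant factor, which primitivity reduces to a sign.

  \<^emph>\<open>The ideals.\<close> Sending \<open>y\<^sub>j\<close> to the monomial \<open>M\<^sub>j\<close> is a
  \<open>\<sigma>\<close>-homomorphism that kills the toric ideal and maps each hyperplane \<open>L\<^sub>i\<close> to
  \<open>P\<^sub>i\<close>, so the Chow ideal is contained in the resultant ideal. Conversely, the equations
  \<open>P\<^sub>i = 0\<close> and \<open>L\<^sub>i = 0\<close> are linear in \<open>u\<^sub>i\<^sub>0\<close> with coefficient 1, so
  eliminating amounts to substituting \<open>u\<^sub>i\<^sub>0 = - \<Sum>\<^sub>j u\<^sub>i\<^sub>j M\<^sub>j\<close> or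
  \<open>u\<^sub>i\<^sub>0 = - \<Sum>\<^sub>j u\<^sub>i\<^sub>j y\<^sub>j\<close>. If \<open>f\<close> lies in the resultant ideal, the
  first substitution turns it into 0 (\<open>substitute_solution_resultant_ideal\<close>). The second
  changes \<open>f\<close> only modulo the \<open>L\<^sub>i\<close> (\<open>dconst_minus_substitute_solution\<close>), and its result
  lies in the kernel of \<open>y\<^sub>j \<mapsto> M\<^sub>j\<close>. That kernel is generated over \<open>\<rat>{U}\<close> by the toric
  ideal (\<open>toric_hom_kernel\<close>).

  \<^emph>\<open>Uniqueness.\<close> The head of a characteristic set has least rank among the nonzero elements of
  the ideal (\<open>characteristic_set_head_least_rank\<close>). So two heads \<open>R\<close> and \<open>C\<close> for the same
  ranking have the same leader and the same degree in it. With their initials \<open>a\<close> and \<open>b\<close>,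
  the element \<open>a C - b R\<close> of the ideal has lower rank and vanishes. Since \<open>R\<close> is irreducible
  and does not divide \<open>a\<close>, which is free of the leader, \<open>R\<close> divides \<open>C\<close>. This step needs
  irreducible polynomials in many variables to be prime (\<open>mpoly_irreducible_dvd_mult\<close>), which
  is Gauss's lemma with induction on the set of variables. As the variables form a set and not a
  sequence of types, the induction runs inside one ring, on the variables that occur.
\<close>

abbreviation (input) "lookup \<equiv> Poly_Mapping.lookup"
abbreviation (input) "keys \<equiv> Poly_Mapping.keys"
abbreviation (input) "single \<equiv> Poly_Mapping.single"


section \<open>Homomorphisms out of monoid rings\<close>

locale cring_hom =
  fixes h :: "'a::comm_ring_1 \<Rightarrow> 'b::comm_ring_1"
  assumes hom_add: "h (a + b) = h a + h b"
    and hom_mult: "h (a * b) = h a * h b"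
    and hom_one: "h 1 = 1"
begin

lemma hom_zero: "h 0 = 0"
  using hom_add[of 0 0] by simp

lemma hom_uminus: "h (- a) = - h a"
  using hom_add[of "- a" a] by (simp add: hom_zero eq_neg_iff_add_eq_0)

lemma hom_diff: "h (a - b) = h a - h b"
  using hom_add[of a "- b"] by (simp add: hom_uminus)

lemma hom_sum: "h (sum f A) = (\<Sum>x\<in>A. h (f x))"
  by (induction A rule: infinite_finite_induct) (auto simp: hom_zero hom_add)

lemma hom_prod: "h (prod f A) = (\<Prod>x\<in>A. h (f x))"
  by (induction A rule: infinite_finite_induct) (auto simp: hom_one hom_mult)

lemma hom_power: "h (a ^ n) = h a ^ n"
  by (induction n) (auto simp: hom_one hom_mult)

end

lemma cring_hom_id: "cring_hom id"
  by unfold_locales auto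

lemma cring_hom_comp:
  assumes "cring_hom f" "cring_hom g"
  shows "cring_hom (\<lambda>x. f (g x))"
proof -
  interpret f: cring_hom f by fact
  interpret g: cring_hom g by fact
  show ?thesis
    by unfold_locales (simp_all add: f.hom_add g.hom_add f.hom_mult g.hom_mult f.hom_one g.hom_one)
qed

lemma cring_hom_funpow:
  fixes f :: "'a::comm_ring_1 \<Rightarrow> 'a"
  assumes "cring_hom f"
  shows "cring_hom (f ^^ k)"
proof (induction k)
  case 0
  show ?case using cring_hom_id by (simp add: id_def cring_hom_def)
next
  case (Suc k)
  show ?case using cring_hom_comp[OF assms Suc.IH] by (simp add: o_def)
qed

lemma cring_hom_dconst:
  "cring_hom (single 0 :: 'a::comm_ring_1 \<Rightarrow> ('e::comm_monoid_add \<Rightarrow>\<^sub>0 'a))"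
  by unfold_locales (simp_all add: single_add mult_single)

lemma poly_mapping_sum_single: "f = (\<Sum>e\<in>keys f. single e (lookup f e))"
proof (rule poly_mapping_eqI)
  fix k
  have "lookup (\<Sum>e\<in>keys f. single e (lookup f e)) k = (\<Sum>e\<in>keys f. if e = k then lookup f e else 0)"
    by (simp add: lookup_sum lookup_single when_def)
  also have "\<dots> = lookup f k"
    by (simp add: in_keys_iff)
  finally show "lookup f k = lookup (\<Sum>e\<in>keys f. single e (lookup f e)) k" by simp
qed

text \<open>
  Evaluation, the shift \<open>\<sigma>\<close>, coefficientwise maps and collecting the powers of one variable
  are all instances, so each of them is a ring homomorphism by the same argument.
\<close>

definition monoid_ring_lift ::
  "('a::zero \<Rightarrow> 'b::comm_ring_1) \<Rightarrow> ('e \<Rightarrow> 'b) \<Rightarrow> ('e \<Rightarrow>\<^sub>0 'a) \<Rightarrow> 'b" where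
  "monoid_ring_lift c m f = (\<Sum>e\<in>keys f. c (lookup f e) * m e)"

lemma monoid_ring_lift_superset:
  assumes "finite K" "keys f \<subseteq> K" "c 0 = 0"
  shows "monoid_ring_lift c m f = (\<Sum>e\<in>K. c (lookup f e) * m e)"
  unfolding monoid_ring_lift_def
  using assms by (intro sum.mono_neutral_left) (auto simp: in_keys_iff)

lemma monoid_ring_lift_single:
  assumes "c 0 = 0"
  shows "monoid_ring_lift c m (single e a) = c a * m e"
  using assms by (simp add: monoid_ring_lift_def)

lemma monoid_ring_lift_add:
  assumes "c 0 = 0" "\<And>a b. c (a + b) = c a + c b"
  shows "monoid_ring_lift c m (f + g) = monoid_ring_lift c m f + monoid_ring_lift c m g"
proof -
  let ?K = "keys f \<union> keys g"
  have "monoid_ring_lift c m (f + g) = (\<Sum>e\<in>?K. c (lookup (f + g) e) * m e)"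
    using assms keys_add[of f g] by (intro monoid_ring_lift_superset) auto
  also have "\<dots> = (\<Sum>e\<in>?K. c (lookup f e) * m e) + (\<Sum>e\<in>?K. c (lookup g e) * m e)"
    by (simp add: lookup_add assms algebra_simps sum.distrib)
  also have "\<dots> = monoid_ring_lift c m f + monoid_ring_lift c m g"
    using assms by (simp add: monoid_ring_lift_superset[of ?K])
  finally show ?thesis .
qed

lemma monoid_ring_lift_sum:
  assumes "c 0 = 0" "\<And>a b. c (a + b) = c a + c b"
  shows "monoid_ring_lift c m (sum f A) = (\<Sum>x\<in>A. monoid_ring_lift c m (f x))"
  by (induction A rule: infinite_finite_induct)
    (auto simp: monoid_ring_lift_add[of c, OF assms], simp_all add: monoid_ring_lift_def)

lemma cring_hom_monoid_ring_lift:
  fixes m :: "'e::comm_monoid_add \<Rightarrow> 'b::comm_ring_1"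
  assumes "cring_hom c" "m 0 = 1" "\<And>a b. m (a + b) = m a * m b"
  shows "cring_hom (monoid_ring_lift c m)"
proof -
  interpret c: cring_hom c by fact
  note c0 = c.hom_zero and cadd = c.hom_add
  let ?L = "monoid_ring_lift c m"
  show ?thesis
  proof
    fix f g :: "'e \<Rightarrow>\<^sub>0 'a"
    show "?L (f + g) = ?L f + ?L g"
      by (rule monoid_ring_lift_add[of c, OF c0 cadd])
    have "f * g = (\<Sum>e\<in>keys f. \<Sum>d\<in>keys g. single (e + d) (lookup f e * lookup g d))"
      unfolding mult_single[symmetric] sum_product[symmetric]
      by (simp flip: poly_mapping_sum_single)
    then have "?L (f * g) = (\<Sum>e\<in>keys f. \<Sum>d\<in>keys g. c (lookup f e * lookup g d) * m (e + d))"
      by (simp add: monoid_ring_lift_sum[of c, OF c0 cadd] monoid_ring_lift_single[of c, OF c0])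
    also have "\<dots> = ?L f * ?L g"
      by (simp add: monoid_ring_lift_def sum_product c.hom_mult assms(3) mult_ac)
    finally show "?L (f * g) = ?L f * ?L g" .
  next
    show "?L 1 = 1"
      using monoid_ring_lift_single[of c m 0 1, OF c0] by (simp add: c.hom_one assms(2))
  qed
qed

lemma single_eq_dconst_times:
  "single e a = single 0 a * (single e 1 :: 'e::comm_monoid_add \<Rightarrow>\<^sub>0 'a::comm_ring_1)"
  by (simp add: mult_single)

lemma cring_hom_eqI_monomials:
  fixes F G :: "('e::comm_monoid_add \<Rightarrow>\<^sub>0 'a::comm_ring_1) \<Rightarrow> 'b::comm_ring_1"
  assumes "cring_hom F" "cring_hom G"
    and "\<And>a. F (single 0 a) = G (single 0 a)" "\<And>e. F (single e 1) = G (single e 1)"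
  shows "F f = G f"
proof -
  interpret F: cring_hom F by fact
  interpret G: cring_hom G by fact
  have "F (single e a) = G (single e a)" for e a
    by (subst (1 2) single_eq_dconst_times) (simp only: F.hom_mult G.hom_mult assms(3,4))
  then show ?thesis
    by (subst (1 2) poly_mapping_sum_single[of f]) (simp only: F.hom_sum G.hom_sum)
qed

abbreviation pvar :: "'x \<Rightarrow> ('x \<Rightarrow>\<^sub>0 nat) \<Rightarrow>\<^sub>0 'a::comm_ring_1" where
  "pvar x \<equiv> single (single x 1) 1"

lemma pvar_power: "pvar x ^ n = (single (single x n) 1 :: ('x \<Rightarrow>\<^sub>0 nat) \<Rightarrow>\<^sub>0 'a::comm_ring_1)"
  by (induction n) (simp_all add: mult_single single_add[symmetric])

lemma prod_single: "(\<Prod>x\<in>A. single (f x) 1) = (single (\<Sum>x\<in>A. f x) 1 :: 'e::comm_monoid_add \<Rightarrow>\<^sub>0 'a::comm_ring_1)"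
  by (induction A rule: infinite_finite_induct) (simp_all add: mult_single)

lemma monomial_eq_prod_pvar:
  "(single e 1 :: ('x \<Rightarrow>\<^sub>0 nat) \<Rightarrow>\<^sub>0 'a::comm_ring_1) = (\<Prod>x\<in>keys e. pvar x ^ lookup e x)"
  unfolding pvar_power prod_single by (subst (1) poly_mapping_sum_single[of e]) (rule refl)

lemma cring_hom_eqI_vars:
  fixes F G :: "(('x \<Rightarrow>\<^sub>0 nat) \<Rightarrow>\<^sub>0 'a::comm_ring_1) \<Rightarrow> 'b::comm_ring_1"
  assumes "cring_hom F" "cring_hom G"
    and "\<And>a. F (single 0 a) = G (single 0 a)" "\<And>x. F (pvar x) = G (pvar x)"
  shows "F f = G f"
proof -
  interpret F: cring_hom F by fact
  interpret G: cring_hom G by fact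
  have "F (single e 1) = G (single e 1)" for e
    by (subst (1 2) monomial_eq_prod_pvar)
      (simp only: F.hom_prod G.hom_prod F.hom_power G.hom_power assms(4))
  then show ?thesis by (rule cring_hom_eqI_monomials[OF assms(1-3)])
qed

lemma pvar_induct [case_names const var add mult]:
  fixes f :: "('x \<Rightarrow>\<^sub>0 nat) \<Rightarrow>\<^sub>0 'a::comm_ring_1"
  assumes const: "\<And>a. P (single 0 a)" and var: "\<And>x. P (pvar x)"
    and add: "\<And>f g. P f \<Longrightarrow> P g \<Longrightarrow> P (f + g)" and mult: "\<And>f g. P f \<Longrightarrow> P g \<Longrightarrow> P (f * g)"
  shows "P f"
proof -
  have P0: "P 0" and P1: "P 1"
    using const[of 0] const[of 1] by simp_all
  have pow: "P (g ^ n)" if "P g" for g n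
    by (induction n) (auto simp: P1 that intro: mult)
  have prod: "P (prod g A)" if "\<And>x. P (g x)" for g :: "'x \<Rightarrow> _" and A
    by (induction A rule: infinite_finite_induct) (auto simp: P1 that intro: mult)
  have single: "P (single e a)" for e a
    by (subst single_eq_dconst_times, subst monomial_eq_prod_pvar)
      (intro mult const prod pow var)
  have sum: "P (sum g A)" if "\<And>x. P (g x)" for g :: "_ \<Rightarrow> _" and A :: "('x \<Rightarrow>\<^sub>0 nat) set"
    by (induction A rule: infinite_finite_induct) (auto simp: P0 that intro: add)
  show ?thesis
    by (subst poly_mapping_sum_single[of f]) (rule sum, rule single)
qed

section \<open>Polynomials in many variables: collecting the powers of one variable\<close>

definition pvars :: "(('x \<Rightarrow>\<^sub>0 nat) \<Rightarrow>\<^sub>0 'a::zero) \<Rightarrow> 'x set" where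
  "pvars f = (\<Union>e\<in>keys f. keys e)"

text \<open>
  The polynomial \<open>f\<close> as a univariate polynomial in \<open>x\<close>. Its coefficients stay in the same ring
  but are free of \<open>x\<close>; this makes an induction on the variables possible within one type.
\<close>

definition as_poly :: "'x \<Rightarrow> (('x \<Rightarrow>\<^sub>0 nat) \<Rightarrow>\<^sub>0 'a::comm_ring_1) \<Rightarrow> (('x \<Rightarrow>\<^sub>0 nat) \<Rightarrow>\<^sub>0 'a) poly" where
  "as_poly x =
    monoid_ring_lift (\<lambda>a. [:single 0 a:]) (\<lambda>e. monom (single (Poly_Mapping.update x 0 e) 1) (lookup e x))"

lemma finite_pvars: "finite (pvars f)"
  by (simp add: pvars_def)

lemma cring_hom_const_poly: "cring_hom (\<lambda>a. [:a:])"
  by unfold_locales (simp_all add: one_pCons)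

lemma update_zero_add:
  "Poly_Mapping.update x 0 (a + b) = Poly_Mapping.update x 0 a + (Poly_Mapping.update x 0 b :: 'x \<Rightarrow>\<^sub>0 nat)"
  by (rule poly_mapping_eqI) (simp add: lookup_update lookup_add)

lemma update_zero_zero: "Poly_Mapping.update x 0 0 = (0 :: 'x \<Rightarrow>\<^sub>0 nat)"
  by (rule poly_mapping_eqI) (simp add: lookup_update)

lemma cring_hom_as_poly: "cring_hom (as_poly x)"
  unfolding as_poly_def
  by (intro cring_hom_monoid_ring_lift cring_hom_comp[OF cring_hom_const_poly cring_hom_dconst])
    (simp_all add: update_zero_zero update_zero_add lookup_add mult_monom mult_single monom_0 one_pCons)

interpretation as_poly: cring_hom "as_poly x" for x
  by (rule cring_hom_as_poly)

lemma coeff_as_poly: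
  "coeff (as_poly x f) i =
    (\<Sum>e | e \<in> keys f \<and> lookup e x = i. single (Poly_Mapping.update x 0 e) (lookup f e))"
proof -
  have "coeff (as_poly x f) i =
      (\<Sum>e\<in>keys f. if lookup e x = i then single (Poly_Mapping.update x 0 e) (lookup f e) else 0)"
    by (simp add: as_poly_def monoid_ring_lift_def coeff_sum smult_monom mult_single
        cong: sum.cong)
  then show ?thesis
    by (simp add: sum.If_cases Int_def)
qed

lemma lookup_coeff_as_poly:
  "lookup (coeff (as_poly x f) i) e = (if lookup e x = 0 then lookup f (Poly_Mapping.update x i e) else 0)"
proof -
  have eq: "lookup d x = i \<and> Poly_Mapping.update x 0 d = e \<longleftrightarrow> lookup e x = 0 \<and> d = Poly_Mapping.update x i e" for d
    by (auto simp: poly_mapping_eq_iff fun_eq_iff lookup_update)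
  have "lookup (coeff (as_poly x f) i) e =
      (\<Sum>d\<in>keys f. if lookup d x = i \<and> Poly_Mapping.update x 0 d = e then lookup f d else 0)"
    unfolding coeff_as_poly lookup_sum lookup_single when_def sum.inter_filter[OF finite_keys]
    by (intro sum.cong refl) (auto simp: lookup_single when_def)
  also have "\<dots> = (\<Sum>d\<in>keys f. if lookup e x = 0 \<and> d = Poly_Mapping.update x i e then lookup f d else 0)"
    by (simp only: eq)
  also have "\<dots> = (if lookup e x = 0 then lookup f (Poly_Mapping.update x i e) else 0)"
    by (auto simp: in_keys_iff)
  finally show ?thesis .
qed

lemma poly_as_poly: "poly (as_poly x f) (pvar x) = f"
proof -
  have upd: "Poly_Mapping.update x 0 e + single x (lookup e x) = (e :: 'a \<Rightarrow>\<^sub>0 nat)" for e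
    by (rule poly_mapping_eqI) (auto simp: lookup_update lookup_add lookup_single when_def)
  have "poly (as_poly x f) (pvar x) = (\<Sum>e\<in>keys f. single e (lookup f e))"
    by (simp add: as_poly_def monoid_ring_lift_def poly_sum poly_monom pvar_power[simplified]
        mult_single upd)
  then show ?thesis
    by (simp flip: poly_mapping_sum_single)
qed

lemma as_poly_eq_0_iff: "as_poly x f = 0 \<longleftrightarrow> f = 0"
  by (metis as_poly.hom_zero poly_0 poly_as_poly)

lemma pvars_coeff_as_poly: "pvars (coeff (as_poly x f) i) \<subseteq> pvars f - {x}"
proof
  fix y assume "y \<in> pvars (coeff (as_poly x f) i)"
  then obtain e where e: "lookup (coeff (as_poly x f) i) e \<noteq> 0" "lookup e y \<noteq> 0"
    by (auto simp: pvars_def in_keys_iff)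
  then have "lookup e x = 0" "lookup f (Poly_Mapping.update x i e) \<noteq> 0"
    by (auto simp: lookup_coeff_as_poly split: if_splits)
  moreover from this e(2) have "y \<noteq> x" by auto
  moreover from this e(2) have "lookup (Poly_Mapping.update x i e) y \<noteq> 0" by (simp add: lookup_update)
  ultimately show "y \<in> pvars f - {x}"
    unfolding pvars_def by (auto simp: in_keys_iff)
qed

lemma as_poly_notin:
  fixes f :: "('x \<Rightarrow>\<^sub>0 nat) \<Rightarrow>\<^sub>0 'a::comm_ring_1"
  assumes "x \<notin> pvars f"
  shows "as_poly x f = [:f:]"
proof (rule poly_eqI, rule poly_mapping_eqI)
  fix i and e :: "'x \<Rightarrow>\<^sub>0 nat"
  have z: "lookup f d = 0" if "lookup d x \<noteq> 0" for d :: "'x \<Rightarrow>\<^sub>0 nat"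
    using assms that unfolding pvars_def by (metis UN_I in_keys_iff)
  have "Poly_Mapping.update x 0 e = e" if "lookup e x = 0"
    using that by (auto simp: poly_mapping_eq_iff fun_eq_iff lookup_update)
  then show "lookup (coeff (as_poly x f) i) e = lookup (coeff [:f:] i) e"
    by (cases i) (auto simp: lookup_coeff_as_poly z lookup_update)
qed

lemma degree_as_poly_ge:
  assumes "e \<in> keys f"
  shows "lookup e x \<le> degree (as_poly x f)"
proof (rule le_degree)
  have upd: "Poly_Mapping.update x (lookup e x) (Poly_Mapping.update x 0 e) = e"
    by (rule poly_mapping_eqI) (auto simp: lookup_update)
  have "lookup (coeff (as_poly x f) (lookup e x)) (Poly_Mapping.update x 0 e) = lookup f e"
    by (simp add: lookup_coeff_as_poly upd, simp add: lookup_update)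
  then show "coeff (as_poly x f) (lookup e x) \<noteq> 0"
    using assms by (auto simp: in_keys_iff)
qed

lemma degree_as_poly_eq_0_iff: "degree (as_poly x f) = 0 \<longleftrightarrow> x \<notin> pvars f"
proof
  assume "degree (as_poly x f) = 0"
  then show "x \<notin> pvars f"
    using degree_as_poly_ge[of _ f x] by (force simp: pvars_def in_keys_iff)
qed (simp add: as_poly_notin)

lemma degree_as_poly:
  "degree (as_poly x f) = Max (insert 0 ((\<lambda>e. lookup e x) ` keys f))"
proof (rule antisym)
  show "degree (as_poly x f) \<le> Max (insert 0 ((\<lambda>e. lookup e x) ` keys f))"
  proof (rule degree_le, intro allI impI)
    fix i assume i: "Max (insert 0 ((\<lambda>e. lookup e x) ` keys f)) < i"
    have "{e. e \<in> keys f \<and> lookup e x = i} = {}"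
      using i by auto
    then show "coeff (as_poly x f) i = 0"
      unfolding coeff_as_poly by (simp only: sum.empty)
  qed
qed (auto intro: degree_as_poly_ge)

lemma pvars_add: "pvars (f + g) \<subseteq> pvars f \<union> pvars g"
  unfolding pvars_def using keys_add[of f g] by blast

lemma pvars_uminus: "pvars (- f) = pvars (f :: _ \<Rightarrow>\<^sub>0 'a::comm_ring_1)"
  unfolding pvars_def by (simp add: in_keys_iff set_eq_iff)

lemma pvars_diff: "pvars (f - g) \<subseteq> pvars f \<union> pvars (g :: _ \<Rightarrow>\<^sub>0 'a::comm_ring_1)"
  using pvars_add[of f "- g"] by (simp add: pvars_uminus)

lemma pvars_mult: "pvars (f * g) \<subseteq> pvars f \<union> pvars (g :: _ \<Rightarrow>\<^sub>0 'a::comm_ring_1)"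
proof
  fix x assume "x \<in> pvars (f * g)"
  then obtain e where "e \<in> keys (f * g)" "x \<in> keys e"
    by (auto simp: pvars_def)
  moreover from this obtain a b where "e = a + b" "a \<in> keys f" "b \<in> keys g"
    using keys_mult[of f g] by blast
  ultimately show "x \<in> pvars f \<union> pvars g"
    using keys_add[of a b] by (auto simp: pvars_def)
qed

lemma pvars_0: "pvars 0 = {}"
  by (simp add: pvars_def)

lemma pvars_1: "pvars 1 = {}"
  by (simp add: pvars_def)

lemma pvars_pvar_power: "pvars (pvar x ^ n) \<subseteq> {x}"
  by (simp add: pvar_power[simplified] pvars_def)

lemma as_poly_pvar_power: "as_poly x (pvar x ^ n) = monom 1 n"
proof -
  have "Poly_Mapping.update x 0 (single x n) = (0 :: 'a \<Rightarrow>\<^sub>0 nat)"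
    by (rule poly_mapping_eqI) (simp add: lookup_update lookup_single when_def)
  then show ?thesis
    unfolding pvar_power by (simp add: as_poly_def monoid_ring_lift_single)
qed

lemma pvars_empty_imp_const:
  assumes "pvars f = {}"
  shows "f = single 0 (lookup f 0)"
proof -
  have "e = 0" if "e \<in> keys f" for e
    using assms that keys_eq_empty[of e] by (auto simp: pvars_def)
  then have "lookup f e = 0" if "e \<noteq> 0" for e
    using that by (auto simp: in_keys_iff)
  then show ?thesis
    by (intro poly_mapping_eqI) (simp add: lookup_single when_def)
qed

text \<open>
  Induction on the number of variables: with respect to one of them, the leading coefficient of
  a product is the product of the leading coefficients, which involve fewer variables.
\<close>

lemma mpoly_no_zero_divisors:
  fixes a b :: "('x \<Rightarrow>\<^sub>0 nat) \<Rightarrow>\<^sub>0 'a::idom"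
  assumes "a * b = 0"
  shows "a = 0 \<or> b = 0"
proof -
  have "finite V \<Longrightarrow> pvars a \<union> pvars b \<subseteq> V \<Longrightarrow> a * b = 0 \<Longrightarrow> a = 0 \<or> b = 0" for V
  proof (induction V arbitrary: a b rule: finite_induct)
    case empty
    have ab: "a = single 0 (lookup a 0)" "b = single 0 (lookup b 0)"
      using empty by (auto intro!: pvars_empty_imp_const)
    have "single 0 (lookup a 0) * single 0 (lookup b 0) = (0 :: ('x \<Rightarrow>\<^sub>0 nat) \<Rightarrow>\<^sub>0 'a)"
      using empty ab by simp
    then have "lookup a 0 * lookup b 0 = 0"
      by (simp add: mult_single) (metis lookup_single_eq lookup_zero mult_eq_0_iff)
    then show ?case using ab by (metis mult_eq_0_iff single_zero)
  next
    case (insert x V)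
    let ?a = "lead_coeff (as_poly x a)" and ?b = "lead_coeff (as_poly x b)"
    have "?a * ?b = 0"
      using coeff_mult_degree_sum[of "as_poly x a" "as_poly x b"] insert.prems
      by (simp add: as_poly.hom_zero flip: as_poly.hom_mult)
    moreover have "pvars ?a \<union> pvars ?b \<subseteq> V"
      using insert.prems pvars_coeff_as_poly[of x a] pvars_coeff_as_poly[of x b] by blast
    ultimately have "?a = 0 \<or> ?b = 0" by (rule insert.IH[rotated])
    then show ?case by (simp add: as_poly_eq_0_iff)
  qed
  from this[of "pvars a \<union> pvars b"] assms show ?thesis by (simp add: finite_pvars)
qed

lemma mpoly_mult_left_cancel:
  fixes a b c :: "('x \<Rightarrow>\<^sub>0 nat) \<Rightarrow>\<^sub>0 'a::idom"
  assumes "a * b = a * c" "a \<noteq> 0"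
  shows "b = c"
  using mpoly_no_zero_divisors[of a "b - c"] assms by (simp add: algebra_simps)

lemma degree_as_poly_mult:
  fixes a b :: "('x \<Rightarrow>\<^sub>0 nat) \<Rightarrow>\<^sub>0 'a::idom"
  assumes "a \<noteq> 0" "b \<noteq> 0"
  shows "degree (as_poly x (a * b)) =
    degree (as_poly x a) + degree (as_poly x b)"
proof (rule antisym)
  have "lead_coeff (as_poly x a) * lead_coeff (as_poly x b) \<noteq> 0"
    using assms mpoly_no_zero_divisors by (metis as_poly_eq_0_iff leading_coeff_0_iff)
  then show "degree (as_poly x a) + degree (as_poly x b)
      \<le> degree (as_poly x (a * b))"
    by (intro le_degree) (simp add: as_poly.hom_mult coeff_mult_degree_sum)
qed (simp add: as_poly.hom_mult degree_mult_le)

text \<open>No variable can cancel in a product, so the polynomials in given variables contain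
  all divisors of their nonzero elements.\<close>

lemma pvars_mult_eq:
  fixes a b :: "('x \<Rightarrow>\<^sub>0 nat) \<Rightarrow>\<^sub>0 'a::idom"
  assumes "a \<noteq> 0" "b \<noteq> 0"
  shows "pvars (a * b) = pvars a \<union> pvars b"
proof -
  have "x \<in> pvars (a * b) \<longleftrightarrow> x \<in> pvars a \<or> x \<in> pvars b" for x
    using degree_as_poly_mult[OF assms, of x] degree_as_poly_eq_0_iff[of x]
    by (metis add_is_0)
  then show ?thesis by auto
qed

lemma pvars_unit:
  fixes c :: "('x \<Rightarrow>\<^sub>0 nat) \<Rightarrow>\<^sub>0 'a::idom"
  assumes "c dvd 1"
  shows "pvars c = {}"
proof -
  obtain d where d: "1 = c * d" using assms by (rule dvdE)
  then have "c \<noteq> 0" "d \<noteq> 0" by auto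
  from pvars_mult_eq[OF this] show ?thesis by (simp add: pvars_1 flip: d)
qed

lemma is_unit_if_pvars_empty:
  fixes c :: "('x \<Rightarrow>\<^sub>0 nat) \<Rightarrow>\<^sub>0 'a::field"
  assumes "pvars c = {}" "c \<noteq> 0"
  shows "c dvd 1"
proof -
  have c: "c = single 0 (lookup c 0)" using assms(1) by (rule pvars_empty_imp_const)
  then have "lookup c 0 \<noteq> 0" using assms(2) by (metis single_zero)
  then have "c * single 0 (inverse (lookup c 0)) = 1"
    by (subst c) (simp add: mult_single)
  then show ?thesis by (metis dvdI)
qed

section \<open>Unique factorization in many variables\<close>

text \<open>
  Primality relative to the variables \<open>V\<close>: the induction on \<open>V\<close> compares an irreducible
  polynomial only with polynomials in the variables reached so far.
\<close>

definition prime_on :: "'x set \<Rightarrow> (('x \<Rightarrow>\<^sub>0 nat) \<Rightarrow>\<^sub>0 'a::comm_ring_1) \<Rightarrow> bool" where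
  "prime_on V p \<longleftrightarrow>
    (\<forall>a b. pvars a \<subseteq> V \<longrightarrow> pvars b \<subseteq> V \<longrightarrow> p dvd a * b \<longrightarrow> p dvd a \<or> p dvd b)"

lemma dvd_iff_dvd_coeffs:
  assumes "x \<notin> pvars p"
  shows "p dvd f \<longleftrightarrow> (\<forall>i. p dvd coeff (as_poly x f) i)"
proof
  assume "p dvd f"
  then obtain q where q: "f = p * q" by (rule dvdE)
  show "\<forall>i. p dvd coeff (as_poly x f) i"
    by (simp add: q as_poly.hom_mult as_poly_notin[OF assms])
next
  assume "\<forall>i. p dvd coeff (as_poly x f) i"
  then have "p dvd poly (as_poly x f) (pvar x)"
    by (subst poly_altdef) (intro dvd_sum dvd_mult2, simp)
  then show "p dvd f" by (simp only: poly_as_poly)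
qed

text \<open>
  One half of Gauss's lemma. If \<open>p\<close> divides neither \<open>a\<close> nor \<open>b\<close>, take the first coefficients
  \<open>a\<^sub>i\<close> and \<open>b\<^sub>j\<close> that it does not divide: modulo \<open>p\<close> the coefficient of \<open>a b\<close> at
  \<open>i + j\<close> is \<open>a\<^sub>i b\<^sub>j\<close>.
\<close>

lemma prime_on_insert:
  assumes p: "prime_on V p" "pvars p \<subseteq> V" and x: "x \<notin> V"
  shows "prime_on (insert x V) p"
  unfolding prime_on_def
proof (intro allI impI, rule ccontr)
  fix a b
  assume a: "pvars a \<subseteq> insert x V" and b: "pvars b \<subseteq> insert x V" and dvd: "p dvd a * b"
    and "\<not> (p dvd a \<or> p dvd b)"
  have xp: "x \<notin> pvars p" using p(2) x by auto
  note dvd_iff = dvd_iff_dvd_coeffs[OF xp]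
  let ?a = "coeff (as_poly x a)" and ?b = "coeff (as_poly x b)"
  have ex: "\<exists>i. \<not> p dvd ?a i" "\<exists>j. \<not> p dvd ?b j"
    using \<open>\<not> (p dvd a \<or> p dvd b)\<close> dvd_iff[of a] dvd_iff[of b] by auto
  define i where "i = (LEAST i. \<not> p dvd ?a i)"
  define j where "j = (LEAST j. \<not> p dvd ?b j)"
  have i: "\<not> p dvd ?a i" and j: "\<not> p dvd ?b j"
    unfolding i_def j_def by (rule LeastI_ex[OF ex(1)], rule LeastI_ex[OF ex(2)])
  have i_lt: "p dvd ?a k" if "k < i" for k
    using not_less_Least[of k "\<lambda>i. \<not> p dvd ?a i"] that
    unfolding i_def by blast
  have j_lt: "p dvd ?b k" if "k < j" for k
    using not_less_Least[of k "\<lambda>i. \<not> p dvd ?b i"] that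
    unfolding j_def by blast
  have "p dvd coeff (as_poly x (a * b)) (i + j)"
    using dvd dvd_iff by blast
  also have "coeff (as_poly x (a * b)) (i + j) = (\<Sum>k\<le>i + j. ?a k * ?b (i + j - k))"
    by (simp add: as_poly.hom_mult coeff_mult)
  also have "\<dots> = ?a i * ?b j + (\<Sum>k\<in>{..i + j} - {i}. ?a k * ?b (i + j - k))"
    by (subst sum.remove[of _ i]) auto
  finally have *: "p dvd ?a i * ?b j + (\<Sum>k\<in>{..i + j} - {i}. ?a k * ?b (i + j - k))" .
  have "p dvd (\<Sum>k\<in>{..i + j} - {i}. ?a k * ?b (i + j - k))"
  proof (rule dvd_sum)
    fix k assume "k \<in> {..i + j} - {i}"
    then have "k < i \<or> i + j - k < j" by auto
    then show "p dvd ?a k * ?b (i + j - k)"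
      using i_lt j_lt by (metis dvd_mult dvd_mult2)
  qed
  with * have "p dvd ?a i * ?b j" by (simp add: dvd_add_left_iff)
  moreover have "pvars (?a i) \<subseteq> V" "pvars (?b j) \<subseteq> V"
    using a b pvars_coeff_as_poly[of x a i] pvars_coeff_as_poly[of x b j] by auto
  ultimately show False using p(1) i j unfolding prime_on_def by blast
qed

text \<open>
  Factoring terminates because the total of the degrees in the single variables is additive.
\<close>

lemma mpoly_factor_induct [consumes 1, case_names unit irreducible mult]:
  fixes f :: "('x \<Rightarrow>\<^sub>0 nat) \<Rightarrow>\<^sub>0 'a::field"
  assumes "f \<noteq> 0"
    and unit: "\<And>u. u dvd 1 \<Longrightarrow> P u" and irreducible: "\<And>p. irreducible p \<Longrightarrow> P p"
    and mult: "\<And>a b. a \<noteq> 0 \<Longrightarrow> b \<noteq> 0 \<Longrightarrow> P a \<Longrightarrow> P b \<Longrightarrow> P (a * b)"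
  shows "P f"
proof -
  define \<mu> where "\<mu> g = (\<Sum>x\<in>pvars f. degree (as_poly x g))"
    for g :: "('x \<Rightarrow>\<^sub>0 nat) \<Rightarrow>\<^sub>0 'a"
  have \<mu>_pos: "0 < \<mu> g" if g: "g \<noteq> 0" "\<not> g dvd 1" "pvars g \<subseteq> pvars f"
    for g :: "('x \<Rightarrow>\<^sub>0 nat) \<Rightarrow>\<^sub>0 'a"
  proof -
    obtain y where "y \<in> pvars g"
      using is_unit_if_pvars_empty[of g] g by blast
    then have "y \<in> pvars f" "0 < degree (as_poly x g)" if "x = y" for x
      using g(3) degree_as_poly_eq_0_iff[of y g] that by auto
    then show ?thesis
      unfolding \<mu>_def by (intro sum_pos2[of _ y] finite_pvars) simp_all
  qed
  have "g \<noteq> 0 \<Longrightarrow> pvars g \<subseteq> pvars f \<Longrightarrow> P g" for g :: "('x \<Rightarrow>\<^sub>0 nat) \<Rightarrow>\<^sub>0 'a"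
  proof (induction "\<mu> g" arbitrary: g rule: less_induct)
    case less
    show ?case
    proof (cases "irreducible g \<or> g dvd 1")
      case True
      then show ?thesis using unit[of g] irreducible[of g] by blast
    next
      case False
      then obtain a b where ab: "g = a * b" "\<not> a dvd 1" "\<not> b dvd 1"
        using less.prems unfolding irreducible_def by blast
      then have nz: "a \<noteq> 0" "b \<noteq> 0" using less.prems by auto
      have sub: "pvars a \<subseteq> pvars f" "pvars b \<subseteq> pvars f"
        using less.prems(2) ab(1) nz by (simp_all add: pvars_mult_eq)
      have "\<mu> g = \<mu> a + \<mu> b"
        by (simp add: \<mu>_def ab(1) degree_as_poly_mult nz sum.distrib)
      moreover have "0 < \<mu> a" "0 < \<mu> b"
        using nz ab(2,3) sub by (blast intro: \<mu>_pos)+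
      ultimately have "\<mu> a < \<mu> g" "\<mu> b < \<mu> g" by simp_all
      then have "P a" "P b" using less.hyps nz sub by blast+
      with nz show ?thesis unfolding ab(1) by (rule mult)
    qed
  qed
  then show ?thesis using assms(1) by blast
qed

text \<open>
  The other half of Gauss's lemma: a denominator \<open>c\<close> that avoids some of the variables can be
  removed, one irreducible factor of \<open>c\<close> at a time.
\<close>

lemma remove_denominator:
  fixes c r f g :: "('x \<Rightarrow>\<^sub>0 nat) \<Rightarrow>\<^sub>0 'a::field"
  assumes prime: "\<And>p :: ('x \<Rightarrow>\<^sub>0 nat) \<Rightarrow>\<^sub>0 'a. irreducible p \<Longrightarrow> pvars p \<subseteq> V \<Longrightarrow> prime_on W p"
    and c: "c \<noteq> 0" "pvars c \<subseteq> V"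
    and fg: "c * r = f * g" "r \<noteq> 0" "pvars f \<subseteq> W" "pvars g \<subseteq> W"
  shows "\<exists>f' g' a b. r = f' * g' \<and> f = a * f' \<and> g = b * g' \<and> pvars a \<subseteq> V \<and> pvars b \<subseteq> V"
  using c fg
proof (induction c arbitrary: r f g rule: mpoly_factor_induct)
  case (unit c)
  obtain d where d: "1 = c * d" using unit.hyps by (rule dvdE)
  have "pvars d = {}" using d by (intro pvars_unit) (metis dvd_triv_right)
  moreover have "r = (d * f) * g" "f = c * (d * f)"
    using unit.prems(2) d by (metis mult.assoc mult.commute mult_1)+
  ultimately show ?case
    using unit.prems(1) by (intro exI[of _ "d * f"] exI[of _ g] exI[of _ c] exI[of _ 1]) (simp add: pvars_1)
next
  case (irreducible p)
  then have p0: "p \<noteq> 0" unfolding irreducible_def by blast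
  have "p dvd f * g" using irreducible.prems(2) by (metis dvd_triv_left)
  then have "p dvd f \<or> p dvd g"
    using prime[OF irreducible.hyps irreducible.prems(1)] irreducible.prems(4,5)
    unfolding prime_on_def by blast
  then show ?case
  proof
    assume "p dvd f"
    then obtain f' where f': "f = p * f'" by (rule dvdE)
    have "r = f' * g"
      by (rule mpoly_mult_left_cancel[OF _ p0]) (use irreducible.prems(2) f' in \<open>simp add: mult_ac\<close>)
    then show ?thesis
      using f' irreducible.prems(1)
      by (intro exI[of _ f'] exI[of _ g] exI[of _ p] exI[of _ 1]) (simp add: pvars_1)
  next
    assume "p dvd g"
    then obtain g' where g': "g = p * g'" by (rule dvdE)
    have "r = f * g'"
      by (rule mpoly_mult_left_cancel[OF _ p0]) (use irreducible.prems(2) g' in \<open>simp add: mult_ac\<close>)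
    then show ?thesis
      using g' irreducible.prems(1)
      by (intro exI[of _ f] exI[of _ g'] exI[of _ 1] exI[of _ p]) (simp add: pvars_1)
  qed
next
  case (mult c d)
  have V: "pvars c \<subseteq> V" "pvars d \<subseteq> V"
    using mult.prems(1) mult.hyps by (simp_all add: pvars_mult_eq)
  have "c * (d * r) = f * g" "d * r \<noteq> 0"
    using mult.prems(2,3) mult.hyps mpoly_no_zero_divisors by (auto simp: mult.assoc)
  then obtain f' g' a b where 1: "d * r = f' * g'" "f = a * f'" "g = b * g'" "pvars a \<subseteq> V" "pvars b \<subseteq> V"
    using mult.IH(1)[OF V(1)] mult.prems(4,5) by metis
  then have "f' \<noteq> 0" "g' \<noteq> 0" "f \<noteq> 0" "g \<noteq> 0"
    using \<open>d * r \<noteq> 0\<close> \<open>c * (d * r) = f * g\<close> mult.hyps mpoly_no_zero_divisors by fastforce+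
  then have "pvars f' \<subseteq> W" "pvars g' \<subseteq> W"
    using mult.prems(4,5) 1 by (metis Un_subset_iff mult_zero_left pvars_mult_eq)+
  then obtain f'' g'' a' b' where 2: "r = f'' * g''" "f' = a' * f''" "g' = b' * g''"
      "pvars a' \<subseteq> V" "pvars b' \<subseteq> V"
    using mult.IH(2)[OF V(2) 1(1) mult.prems(3)] by metis
  have "pvars (a * a') \<subseteq> V" "pvars (b * b') \<subseteq> V"
    using 1(4,5) 2(4,5) pvars_mult[of a a'] pvars_mult[of b b'] by blast+
  moreover have "f = (a * a') * f''" "g = (b * b') * g''"
    using 1(2,3) 2(2,3) by (simp_all only: mult.assoc)
  ultimately show ?case using 2(1) by blast
qed

lemma dvd_if_dvd_const_multiple:
  fixes p c f :: "('x \<Rightarrow>\<^sub>0 nat) \<Rightarrow>\<^sub>0 'a::field"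
  assumes prime: "\<And>p :: ('x \<Rightarrow>\<^sub>0 nat) \<Rightarrow>\<^sub>0 'a. irreducible p \<Longrightarrow> pvars p \<subseteq> V \<Longrightarrow> prime_on W p"
    and c: "c \<noteq> 0" "pvars c \<subseteq> V"
    and p: "irreducible p" "\<not> pvars p \<subseteq> V" "p dvd c * f" and W: "V \<subseteq> W" "pvars f \<subseteq> W"
  shows "p dvd f"
proof (cases "f = 0")
  case False
  obtain r where r: "c * f = p * r" using p(3) by (rule dvdE)
  have cf: "c * f \<noteq> 0" using mpoly_no_zero_divisors c False by blast
  then have nz: "p \<noteq> 0" "r \<noteq> 0" using r by auto
  have "pvars (c * f) \<subseteq> W" using pvars_mult[of c f] c W by blast
  then have "pvars p \<subseteq> W" "pvars r \<subseteq> W" using r nz by (simp_all add: pvars_mult_eq)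
  then obtain p' r' a b where *: "f = p' * r'" "p = a * p'" "r = b * r'" "pvars a \<subseteq> V"
    using remove_denominator[OF prime c r False] by blast
  have "\<not> p' dvd 1"
    using pvars_unit[of p'] pvars_mult[of a p'] p(2) *(2,4) by auto
  then have "a dvd 1"
    using p(1) *(2) unfolding irreducible_def by blast
  then have "p dvd p'" using *(2) by (metis mult_dvd_mono dvd_refl mult_1)
  then show ?thesis using *(1) by simp
qed simp

text \<open>
  An element \<open>g\<close> of least degree in \<open>x\<close> of an ideal \<open>J\<close> divides every element of it,
  up to denominators free of \<open>x\<close>: pseudo-division by \<open>g\<close> stays in the ideal and leaves no
  remainder.
\<close>

lemma pseudo_divides_if_least_degree:
  fixes g :: "('x \<Rightarrow>\<^sub>0 nat) \<Rightarrow>\<^sub>0 'a::field"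
  assumes x: "x \<notin> V"
    and J: "\<And>f. f \<in> J \<Longrightarrow> pvars f \<subseteq> insert x V"
      "\<And>f h a b. f \<in> J \<Longrightarrow> h \<in> J \<Longrightarrow> pvars a \<subseteq> insert x V \<Longrightarrow> pvars b \<subseteq> insert x V \<Longrightarrow> a * f - b * h \<in> J"
    and g: "g \<in> J" "g \<noteq> 0"
      "\<And>f. f \<in> J \<Longrightarrow> f \<noteq> 0 \<Longrightarrow> degree (as_poly x g) \<le> degree (as_poly x f)"
    and f: "f \<in> J"
  shows "\<exists>c q. c \<noteq> 0 \<and> pvars c \<subseteq> V \<and> pvars q \<subseteq> insert x V \<and> c * f = q * g"
  using f
proof (induction "degree (as_poly x f)" arbitrary: f rule: less_induct)
  case less
  show ?case
  proof (cases "f = 0")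
    case True
    then show ?thesis by (intro exI[of _ 1] exI[of _ 0]) (simp add: pvars_0 pvars_1)
  next
    case False
    let ?lf = "lead_coeff (as_poly x f)" and ?lg = "lead_coeff (as_poly x g)"
    define k where "k = degree (as_poly x f) - degree (as_poly x g)"
    have deg: "degree (as_poly x f) = k + degree (as_poly x g)"
      using g(3)[OF less.prems False] by (simp add: k_def)
    have lg: "?lg \<noteq> 0" "pvars ?lg \<subseteq> V" and lf: "pvars ?lf \<subseteq> V"
      using g(2) J(1)[OF g(1)] J(1)[OF less.prems] pvars_coeff_as_poly[of x] 
      by (simp_all add: as_poly_eq_0_iff) blast+
    have q: "pvars (?lf * pvar x ^ k) \<subseteq> insert x V"
      using pvars_mult[of ?lf "pvar x ^ k"] pvars_pvar_power[of x k] lf by blast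
    define r where "r = ?lg * f - ?lf * pvar x ^ k * g"
    have rJ: "r \<in> J"
      unfolding r_def using less.prems g(1) lg q by (intro J(2)) auto
    have r: "as_poly x r = smult ?lg (as_poly x f) - smult ?lf (monom 1 k * as_poly x g)"
    proof -
      have "x \<notin> pvars ?lg" "x \<notin> pvars ?lf"
        using lg(2) lf x by blast+
      then show ?thesis
        unfolding r_def as_poly.hom_diff as_poly.hom_mult as_poly_pvar_power
        by (simp add: as_poly_notin)
    qed
    have "degree (as_poly x r) \<le> degree (as_poly x f)"
      unfolding r
      by (intro degree_diff_le degree_smult_le order_trans[OF degree_smult_le]
          order_trans[OF degree_mult_le] order_trans[OF add_right_mono[OF degree_monom_le]])
        (simp_all add: deg)
    moreover have "coeff (as_poly x r) (degree (as_poly x f)) = 0"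
      by (simp add: r coeff_monom_mult deg mult.commute)
    ultimately have "r = 0 \<or> degree (as_poly x r) < degree (as_poly x f)"
      by (metis as_poly_eq_0_iff leading_coeff_0_iff le_neq_implies_less)
    then obtain c q' where c: "c \<noteq> 0" "pvars c \<subseteq> V" "pvars q' \<subseteq> insert x V" "c * r = q' * g"
      using less.hyps[OF _ rJ] by (metis mult_zero_left mult_zero_right one_neq_zero pvars_0 pvars_1 empty_subsetI)
    have "(c * ?lg) * f = (q' + c * (?lf * pvar x ^ k)) * g"
      using c(4) by (simp add: r_def algebra_simps)
    moreover have "c * ?lg \<noteq> 0" using mpoly_no_zero_divisors c(1) lg(1) by blast
    moreover have "pvars (c * ?lg) \<subseteq> V" using pvars_mult[of c ?lg] c lg by blast
    moreover have "pvars (q' + c * (?lf * pvar x ^ k)) \<subseteq> insert x V"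
      using pvars_add[of q' "c * (?lf * pvar x ^ k)"] pvars_mult[of c "?lf * pvar x ^ k"] c q by blast
    ultimately show ?thesis by blast
  qed
qed

text \<open>
  Gauss's lemma without fraction fields. If \<open>x\<close> occurs in \<open>p\<close> and \<open>g\<close> is an element of least
  degree in \<open>x\<close> of the ideal \<open>(p, a)\<close>, then \<open>g\<close> divides \<open>p\<close> and \<open>a\<close> up to denominators
  free of \<open>x\<close>, like a greatest common divisor over the fraction field of the coefficients.
  Since \<open>p\<close> is irreducible, \<open>g\<close> is \<open>p\<close> or a unit, up to such denominators.
\<close>

lemma prime_on_if_irreducible:
  fixes p :: "('x \<Rightarrow>\<^sub>0 nat) \<Rightarrow>\<^sub>0 'a::field"
  assumes "finite V" "irreducible p" "pvars p \<subseteq> V"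
  shows "prime_on V p"
  using assms
proof (induction V arbitrary: p rule: finite_induct)
  case empty
  then have "p dvd 1"
    by (intro is_unit_if_pvars_empty) (auto simp: irreducible_def)
  then show ?case using empty by (simp add: irreducible_def)
next
  case (insert x V)
  let ?W = "insert x V"
  have prime: "prime_on ?W q" if "irreducible q" "pvars q \<subseteq> V" for q :: "('x \<Rightarrow>\<^sub>0 nat) \<Rightarrow>\<^sub>0 'a"
    using insert.IH[OF that] that(2) insert.hyps(2) by (rule prime_on_insert)
  show ?case
  proof (cases "pvars p \<subseteq> V")
    case True
    then show ?thesis using prime insert.prems by blast
  next
    case False
    have p0: "p \<noteq> 0" using insert.prems unfolding irreducible_def by blast
    have cancel: "p dvd f" if "p dvd c * f" "c \<noteq> 0" "pvars c \<subseteq> V" "pvars f \<subseteq> ?W" for c f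
      using prime that(2,3) insert.prems(1) False that(1) _ that(4)
      by (rule dvd_if_dvd_const_multiple) auto
    show ?thesis
      unfolding prime_on_def
    proof (intro allI impI)
      fix a b
      assume a: "pvars a \<subseteq> ?W" and b: "pvars b \<subseteq> ?W" and dvd: "p dvd a * b"
      define J where "J = {s * p + t * a | s t. pvars s \<subseteq> ?W \<and> pvars t \<subseteq> ?W}"
      have pJ: "p \<in> J"
        unfolding J_def by (rule CollectI, rule exI[of _ 1], rule exI[of _ 0]) (simp add: pvars_0 pvars_1)
      have aJ: "a \<in> J"
        unfolding J_def by (rule CollectI, rule exI[of _ 0], rule exI[of _ 1]) (simp add: pvars_0 pvars_1)
      have JW: "pvars f \<subseteq> ?W" if "f \<in> J" for f
      proof -
        obtain s t where "f = s * p + t * a" "pvars s \<subseteq> ?W" "pvars t \<subseteq> ?W"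
          using \<open>f \<in> J\<close> unfolding J_def by blast
        then show ?thesis
          using pvars_add[of "s * p" "t * a"] pvars_mult[of s p] pvars_mult[of t a] a insert.prems(2)
          by blast
      qed
      have Jclosed: "c * f - d * h \<in> J"
        if fh: "f \<in> J" "h \<in> J" and cd: "pvars c \<subseteq> ?W" "pvars d \<subseteq> ?W" for f h c d
      proof -
        obtain s t where f: "f = s * p + t * a" "pvars s \<subseteq> ?W" "pvars t \<subseteq> ?W"
          using fh(1) unfolding J_def by blast
        obtain s' t' where h: "h = s' * p + t' * a" "pvars s' \<subseteq> ?W" "pvars t' \<subseteq> ?W"
          using fh(2) unfolding J_def by blast
        have "c * f - d * h = (c * s - d * s') * p + (c * t - d * t') * a"
          by (simp add: f(1) h(1) algebra_simps)
        moreover have "pvars (c * s - d * s') \<subseteq> ?W"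
          using pvars_diff[of "c * s" "d * s'"] pvars_mult[of c s] pvars_mult[of d s'] f(2) h(2) cd
          by blast
        moreover have "pvars (c * t - d * t') \<subseteq> ?W"
          using pvars_diff[of "c * t" "d * t'"] pvars_mult[of c t] pvars_mult[of d t'] f(3) h(3) cd
          by blast
        ultimately show ?thesis unfolding J_def by blast
      qed
      obtain g where g: "g \<in> J" "g \<noteq> 0"
        "\<And>f. f \<in> J \<Longrightarrow> f \<noteq> 0 \<Longrightarrow> degree (as_poly x g) \<le> degree (as_poly x f)"
        using ex_has_least_nat[of "\<lambda>f. f \<in> J \<and> f \<noteq> 0" p "\<lambda>f. degree (as_poly x f)"] pJ p0
        by blast
      have g_divides: "\<exists>c q. c \<noteq> 0 \<and> pvars c \<subseteq> V \<and> pvars q \<subseteq> ?W \<and> c * f = q * g" if "f \<in> J" for f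
        using insert.hyps(2) JW Jclosed g that by (rule pseudo_divides_if_least_degree)
      obtain c q where c: "c \<noteq> 0" "pvars c \<subseteq> V" "pvars q \<subseteq> ?W" "c * p = q * g"
        using g_divides[OF pJ] by blast
      obtain q' g' c\<^sub>1 c\<^sub>2 where p_eq: "p = q' * g'" and g_eq: "g = c\<^sub>2 * g'" "pvars c\<^sub>2 \<subseteq> V"
        using remove_denominator[OF prime c(1,2,4) p0 c(3) JW[OF g(1)]] by blast
      have "q' dvd 1 \<or> g' dvd 1"
        using insert.prems(1) p_eq unfolding irreducible_def by blast
      then show "p dvd a \<or> p dvd b"
      proof
        \<comment> \<open>Here \<open>g\<close> is \<open>p\<close> up to a denominator, and \<open>p\<close> divides \<open>a\<close>.\<close>
        assume "q' dvd 1"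
        then have "p dvd g" unfolding p_eq g_eq
          by (metis dvd_mult dvd_refl mult_1 mult_dvd_mono)
        obtain d r where d: "d \<noteq> 0" "pvars d \<subseteq> V" "d * a = r * g"
          using g_divides[OF aJ] by blast
        have "p dvd d * a" using \<open>p dvd g\<close> d(3) by simp
        then show ?thesis using cancel[of d a] d a by blast
      next
        \<comment> \<open>Here \<open>g\<close> is free of \<open>x\<close>, a Bezout denominator: \<open>g b = s p b + t a b\<close>.\<close>
        assume "g' dvd 1"
        then have "pvars g \<subseteq> V"
          using pvars_unit[of g'] pvars_mult[of c\<^sub>2 g'] g_eq by auto
        obtain s t where st: "g = s * p + t * a" using g(1) unfolding J_def by blast
        have "g * b = p * (s * b) + t * (a * b)" by (simp add: st algebra_simps)
        then have "p dvd g * b" using dvd by simp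
        then show ?thesis using cancel[of g b] g(2) \<open>pvars g \<subseteq> V\<close> b by blast
      qed
    qed
  qed
qed

theorem mpoly_irreducible_dvd_mult:
  fixes p :: "('x \<Rightarrow>\<^sub>0 nat) \<Rightarrow>\<^sub>0 'a::field"
  assumes "irreducible p" "p dvd a * b"
  shows "p dvd a \<or> p dvd b"
  using prime_on_if_irreducible[of "pvars p \<union> pvars a \<union> pvars b" p] assms
  by (auto simp: prime_on_def finite_pvars)

section \<open>Polynomials of least rank in an ideal\<close>

lemma dvars_eq_pvars: "dvars f = pvars f"
  by (simp add: dvars_def pvars_def)

lemma deg_in_eq_degree: "deg_in f x = degree (as_poly x f)"
  by (simp add: deg_in_def degree_as_poly)

lemma deg_in_pos_iff: "0 < deg_in f x \<longleftrightarrow> x \<in> dvars f"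
  unfolding deg_in_eq_degree dvars_eq_pvars by (metis degree_as_poly_eq_0_iff not_gr_zero)

locale ranked =
  fixes r :: "('v \<times> nat) rel"
  assumes ranking: "ranking r"
begin

lemma trans_r: "(x, y) \<in> r \<Longrightarrow> (y, z) \<in> r \<Longrightarrow> (x, z) \<in> r"
  using ranking unfolding ranking_def strict_linear_order_on_def by (meson transE)

lemma irrefl_r: "(x, x) \<notin> r"
  using ranking unfolding ranking_def strict_linear_order_on_def by (meson irrefl_def)

lemma total_r: "x \<noteq> y \<Longrightarrow> (x, y) \<in> r \<or> (y, x) \<in> r"
  using ranking unfolding ranking_def strict_linear_order_on_def by (meson UNIV_I total_on_def)

lemma transform_r: "0 < l \<Longrightarrow> ((v, k), (v, k + l)) \<in> r"
proof (induction l)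
  case (Suc l)
  have step: "((v, j), (v, Suc j)) \<in> r" for j
    using ranking unfolding ranking_def by blast
  show ?case
    using Suc.IH step[of "k + l"] trans_r by (cases l) auto
qed simp

lemma leader_greatest:
  assumes "dvars f \<noteq> {}"
  shows "leader r f \<in> dvars f" "\<And>y. y \<in> dvars f \<Longrightarrow> y \<noteq> leader r f \<Longrightarrow> (y, leader r f) \<in> r"
proof -
  have "finite X \<Longrightarrow> X \<noteq> {} \<Longrightarrow> \<exists>x\<in>X. \<forall>y\<in>X. y \<noteq> x \<longrightarrow> (y, x) \<in> r" for X
  proof (induction X rule: finite_ne_induct)
    case (insert z X)
    then obtain x where x: "x \<in> X" "\<And>y. y \<in> X \<Longrightarrow> y \<noteq> x \<Longrightarrow> (y, x) \<in> r" by blast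
    show ?case
    proof (cases "(z, x) \<in> r")
      case True
      then show ?thesis using x by blast
    next
      case False
      then have "(x, z) \<in> r" using total_r[of x z] x insert.hyps by blast
      then show ?thesis using x trans_r by (metis insert_iff)
    qed
  qed simp
  from this[of "dvars f"] assms
  have "\<exists>x. x \<in> dvars f \<and> (\<forall>y\<in>dvars f. y \<noteq> x \<longrightarrow> (y, x) \<in> r)"
    by (auto simp: dvars_eq_pvars finite_pvars)
  moreover have "x = y"
    if "x \<in> dvars f \<and> (\<forall>y\<in>dvars f. y \<noteq> x \<longrightarrow> (y, x) \<in> r)"
      "y \<in> dvars f \<and> (\<forall>z\<in>dvars f. z \<noteq> y \<longrightarrow> (z, y) \<in> r)" for x y
    using that trans_r[of x y x] irrefl_r[of x] by metis
  ultimately have "\<exists>!x. x \<in> dvars f \<and> (\<forall>y\<in>dvars f. y \<noteq> x \<longrightarrow> (y, x) \<in> r)"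
    by (rule ex_ex1I)
  from theI'[OF this]
  show "leader r f \<in> dvars f" "\<And>y. y \<in> dvars f \<Longrightarrow> y \<noteq> leader r f \<Longrightarrow> (y, leader r f) \<in> r"
    unfolding leader_def by auto
qed

lemma lower_rank_trans:
  assumes "lower_rank r f g" "lower_rank r g h"
  shows "lower_rank r f h"
  using assms trans_r unfolding lower_rank_def by (smt (verit) order.strict_trans)

text \<open>
  A polynomial that is not reduced with respect to \<open>a\<close> contains a transform of the leader of
  \<open>a\<close>, and a ranking puts every transform of a variable above it.
\<close>

lemma reduced_if_lower_rank:
  assumes "lower_rank r f a"
  shows "reduced r f a"
proof (rule ccontr)
  assume "\<not> reduced r f a"
  have a: "dvars a \<noteq> {}" using assms by (simp add: lower_rank_def)
  obtain v k where vk: "leader r a = (v, k)" by (cases "leader r a")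
  obtain l where l: "deg_in a (v, k) \<le> deg_in f (v, k + l)"
    using \<open>\<not> reduced r f a\<close> a vk unfolding reduced_def by (auto simp: not_less)
  have "0 < deg_in a (v, k)"
    using leader_greatest(1)[OF a] vk by (simp add: deg_in_pos_iff)
  then have in_f: "(v, k + l) \<in> dvars f"
    using l by (simp flip: deg_in_pos_iff)
  then have f: "dvars f \<noteq> {}" by auto
  have le_f: "(v, k + l) = leader r f \<or> ((v, k + l), leader r f) \<in> r"
    using leader_greatest(2)[OF f in_f] by blast
  have up: "((v, k + l), (v, k)) \<notin> r"
    using transform_r[of l v k] trans_r[of "(v, k)" "(v, k + l)" "(v, k)"] irrefl_r[of "(v, k)"]
    by (cases "l = 0") auto
  have "(leader r f, (v, k)) \<notin> r"
    using le_f up trans_r[of "(v, k + l)" "leader r f" "(v, k)"] by auto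
  then have eq: "leader r f = (v, k)" and less: "deg_in f (v, k) < deg_in a (v, k)"
    using assms f vk by (auto simp: lower_rank_def)
  have "l = 0"
    using le_f eq up by simp
  then show False using l less by simp
qed

text \<open>
  The other elements of the chain have higher rank than its head, so a polynomial of lower rank
  than the head is reduced with respect to the whole chain.
\<close>

lemma characteristic_set_head_least_rank:
  assumes "characteristic_set r I (R # A)" "f \<in> I" "lower_rank r f R"
  shows "f = 0"
proof -
  have chain: "lower_rank r ((R # A) ! i) ((R # A) ! j)" if "i < j" "j < length (R # A)" for i j
    using assms(1) that by (simp add: characteristic_set_def ascending_chain_def)
  have lower: "lower_rank r f a" if a: "a \<in> set (R # A)" for a
  proof -
    obtain j where j: "j < length (R # A)" "(R # A) ! j = a"
      using a unfolding in_set_conv_nth by blast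
    show ?thesis
    proof (cases "j = 0")
      case True
      then show ?thesis using j assms(3) by simp
    next
      case False
      then have "lower_rank r R a" using chain[of 0 j] j by simp
      with assms(3) show ?thesis by (rule lower_rank_trans)
    qed
  qed
  have "reduced r f a" if "a \<in> set (R # A)" for a
    using lower[OF that] by (rule reduced_if_lower_rank)
  then show ?thesis
    using assms(1,2) unfolding characteristic_set_def by blast
qed

text \<open>
  The initials combine two polynomials of equal rank into one of lower rank, which must vanish.
  So each of them divides a product of the other with a polynomial free of the leader, and
  unique factorization removes that factor.
\<close>

lemma irreducible_least_rank_dvd:
  assumes ideal: "\<And>f g. f \<in> I \<Longrightarrow> g \<in> I \<Longrightarrow> f - g \<in> I" "\<And>h f. f \<in> I \<Longrightarrow> h * f \<in> I"
    and f: "f \<in> I" "dvars f \<noteq> {}" "\<And>h. h \<in> I \<Longrightarrow> lower_rank r h f \<Longrightarrow> h = 0"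
    and g: "g \<in> I" "dvars g \<noteq> {}" "\<And>h. h \<in> I \<Longrightarrow> lower_rank r h g \<Longrightarrow> h = 0"
    and irred: "irreducible f"
  shows "f dvd g"
proof -
  define x where "x = leader r f"
  define d where "d = deg_in f x"
  have nz: "f \<noteq> 0" "g \<noteq> 0" using f(2) g(2) by (auto simp: dvars_def)
  have "\<not> lower_rank r f g" "\<not> lower_rank r g f" using f g nz by blast+
  then have xg: "leader r g = x" and dg: "deg_in g x = d"
    using f(2) g(2) total_r[of "leader r f" "leader r g"]
    unfolding lower_rank_def x_def d_def by (metis linorder_neqE_nat)+
  have x: "x \<in> dvars f" using leader_greatest(1)[OF f(2)] by (simp add: x_def)
  have d: "0 < d" using x by (simp add: d_def deg_in_pos_iff)
  let ?f = "as_poly x f" and ?g = "as_poly x g"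
  have deg: "degree ?f = d" "degree ?g = d"
    using dg by (simp_all add: d_def deg_in_eq_degree)
  define a where "a = lead_coeff ?f"
  define b where "b = lead_coeff ?g"
  have a: "pvars a \<subseteq> pvars f - {x}" and b: "pvars b \<subseteq> pvars g - {x}"
    unfolding a_def b_def by (rule pvars_coeff_as_poly)+
  define h where "h = a * g - b * f"
  have "h \<in> I" unfolding h_def by (intro ideal f g)
  have as_h: "as_poly x h = smult a ?g - smult b ?f"
    using a b by (simp add: h_def as_poly.hom_diff as_poly.hom_mult as_poly_notin subset_Diff_insert)
  have "degree (as_poly x h) \<le> d"
    unfolding as_h using deg by (intro degree_diff_le order_trans[OF degree_smult_le]) simp_all
  moreover have "coeff (as_poly x h) d = 0"
    unfolding as_h a_def b_def using deg by (simp add: mult.commute)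
  ultimately have deg_h: "deg_in h x < d"
    using d unfolding deg_in_eq_degree
    by (metis degree_0 leading_coeff_0_iff le_neq_implies_less)
  have "lower_rank r h f"
  proof (cases "dvars h = {}")
    case False
    have "leader r h \<in> dvars h" by (rule leader_greatest(1)[OF False])
    also have "dvars h \<subseteq> dvars f \<union> dvars g"
      using pvars_diff[of "a * g" "b * f"] pvars_mult[of a g] pvars_mult[of b f] a b
      unfolding h_def dvars_eq_pvars by blast
    finally have "leader r h = x \<or> (leader r h, x) \<in> r"
      using leader_greatest(2)[OF f(2), of "leader r h"] leader_greatest(2)[OF g(2), of "leader r h"] xg
      unfolding x_def by (metis UnE)
    then show ?thesis
      using f(2) deg_h by (auto simp: lower_rank_def d_def simp flip: x_def)
  qed (use f(2) in \<open>simp add: lower_rank_def\<close>)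
  then have "h = 0" using f(3) \<open>h \<in> I\<close> by blast
  then have "f dvd a * g" by (simp add: h_def)
  then have "f dvd a \<or> f dvd g" by (rule mpoly_irreducible_dvd_mult[OF irred])
  moreover have "\<not> f dvd a"
  proof
    assume "f dvd a"
    then obtain q where q: "a = f * q" by (rule dvdE)
    have "a \<noteq> 0" using nz by (simp add: a_def as_poly_eq_0_iff)
    then have "pvars a = pvars f \<union> pvars q" using q by (metis mult_zero_left mult_zero_right pvars_mult_eq)
    then show False using a x by (auto simp: dvars_eq_pvars)
  qed
  ultimately show ?thesis by blast
qed

end

lemma dvars_irreducible:
  assumes "irreducible f"
  shows "dvars f \<noteq> {}"
  using assms is_unit_if_pvars_empty[of f] by (auto simp: irreducible_def dvars_eq_pvars)

lemma irreducible_dvd_imp_const_multiple: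
  fixes f g :: "('x \<Rightarrow>\<^sub>0 nat) \<Rightarrow>\<^sub>0 'a::field"
  assumes "irreducible f" "irreducible g" "f dvd g"
  obtains q where "g = single 0 q * f"
proof -
  obtain c where c: "g = f * c" using assms(3) by (rule dvdE)
  then have "c dvd 1" using assms(1,2) unfolding irreducible_def by blast
  then have "c = single 0 (lookup c 0)" by (intro pvars_empty_imp_const pvars_unit)
  then show ?thesis using c that by (metis mult.commute)
qed

text \<open>
  If \<open>q = a / b\<close>, then \<open>b g = a f\<close> is an identity of integer polynomials; their contents are
  \<open>\<bar>b\<bar>\<close> and \<open>\<bar>a\<bar>\<close>.
\<close>

lemma primitive_integral_const_multiple:
  assumes f: "primitive_integral f" and g: "primitive_integral g" and "g = dconst q * f"
  shows "g = f \<or> g = - f"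
proof -
  have gf: "lookup g e = q * lookup f e" for e
    unfolding assms(3) by (simp flip: mult_map_scale_conv_mult add: Poly_Mapping.map.rep_eq when_def)
  obtain a b where ab: "q = rat_of_int a / rat_of_int b" "b \<noteq> 0"
    by (cases q) (auto simp: Fract_of_int_quotient)
  define m where "m h e = \<lfloor>lookup h e\<rfloor>" for h :: "('a, rat) dpoly" and e
  have m: "lookup f e = of_int (m f e)" "lookup g e = of_int (m g e)" for e
    using f g by (auto simp: primitive_integral_def m_def elim: Ints_cases)
  have Gcd: "Gcd (m f ` keys f) = 1" "Gcd (m g ` keys g) = 1"
    using f g by (simp_all add: primitive_integral_def m_def)
  have "g \<noteq> 0"
    using Gcd(2) by auto
  then have q0: "q \<noteq> 0"
    using assms(3) by auto
  have keys: "keys g = keys f"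
    using gf q0 by (auto simp: in_keys_iff)
  have "rat_of_int (b * m g e) = rat_of_int (a * m f e)" for e
    using gf[of e] ab(2) by (simp add: m ab(1) field_simps)
  then have "b * m g e = a * m f e" for e
    by (simp only: of_int_eq_iff)
  then have "(*) b ` m g ` keys g = (*) a ` m f ` keys f"
    by (simp add: image_image keys)
  then have "normalize b = normalize a"
    using Gcd by (metis Gcd_mult mult.right_neutral)
  then have "b = a \<or> b = - a" by (simp add: abs_eq_iff normalize_int_def)
  then have "q = 1 \<or> q = - 1" using ab by (elim disjE) simp_all
  then have "lookup g e = lookup f e" if "q \<noteq> - 1" for e
    using gf that by simp
  moreover have "lookup g e = - lookup f e" if "q = - 1" for e
    using gf that by simp
  ultimately show ?thesis
    by (metis lookup_uminus poly_mapping_eqI)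
qed

theorem heads_characteristic_set_unique:
  assumes "ranking r"
    and ideal: "\<And>f g. f \<in> I \<Longrightarrow> g \<in> I \<Longrightarrow> f - g \<in> I" "\<And>h f. f \<in> I \<Longrightarrow> h * f \<in> I"
    and R: "irreducible R" "primitive_integral R" "heads_characteristic_set r I R"
    and C: "irreducible C" "primitive_integral C" "heads_characteristic_set r I C"
  shows "R = C \<or> R = - C"
proof -
  interpret ranked r by unfold_locales fact
  obtain A B where A: "characteristic_set r I (R # A)" and B: "characteristic_set r I (C # B)"
    using R(3) C(3) unfolding heads_characteristic_set_def by blast
  have in_I: "C \<in> I" "R \<in> I"
    using A B by (auto simp: characteristic_set_def)
  have "C dvd R"
    using ideal in_I(1) dvars_irreducible[OF C(1)] characteristic_set_head_least_rank[OF B]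
      in_I(2) dvars_irreducible[OF R(1)] characteristic_set_head_least_rank[OF A] C(1)
    by (rule irreducible_least_rank_dvd)
  then obtain q where "R = dconst q * C"
    by (rule irreducible_dvd_imp_const_multiple[OF C(1) R(1)])
  then show ?thesis by (rule primitive_integral_const_multiple[OF C(2) R(2)])
qed

section \<open>Difference operators and \<open>\<sigma>\<close>-ideals\<close>

lemma lookup_shift_exp_0: "lookup (shift_exp e) (v, 0) = 0"
  unfolding shift_exp_def by (simp add: lookup_sum lookup_single case_prod_unfold)

lemma lookup_shift_exp_Suc: "lookup (shift_exp e) (v, Suc k) = lookup e (v, k)"
proof -
  have "lookup (shift_exp e) (v, Suc k) = (\<Sum>x\<in>keys e. if x = (v, k) then lookup e x else 0)"
    unfolding shift_exp_def lookup_sum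
    by (intro sum.cong refl) (auto simp: lookup_single when_def split: if_splits)
  then show ?thesis by (simp add: in_keys_iff)
qed

lemma shift_exp_eqI:
  assumes "\<And>v. lookup a (v, 0) = lookup b (v, 0)" "\<And>v k. lookup a (v, Suc k) = lookup b (v, Suc k)"
  shows "a = b"
proof (rule poly_mapping_eqI)
  fix x
  show "lookup a x = lookup b x"
    using assms by (cases x; cases "snd x") auto
qed

lemma shift_exp_0: "shift_exp 0 = 0"
  by (simp add: shift_exp_def)

lemma shift_exp_add: "shift_exp (a + b) = shift_exp a + shift_exp b"
  by (rule shift_exp_eqI) (simp_all add: lookup_add lookup_shift_exp_0 lookup_shift_exp_Suc)

lemma shift_exp_single: "shift_exp (single (v, k) n) = single (v, Suc k) n"
  by (cases "n = 0") (simp_all add: shift_exp_def)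

lemma dshift_eq_lift:
  "dshift s = monoid_ring_lift (\<lambda>a. single 0 (s a)) (\<lambda>e. single (shift_exp e) 1)"
  by (rule ext) (simp add: dshift_def monoid_ring_lift_def mult_single)

lemma cring_hom_dshift:
  assumes "cring_hom s"
  shows "cring_hom (dshift s)"
  unfolding dshift_eq_lift
  by (intro cring_hom_monoid_ring_lift cring_hom_comp[OF cring_hom_dconst assms])
    (simp_all add: shift_exp_0 shift_exp_add mult_single)

lemma dshift_single:
  assumes "cring_hom s"
  shows "dshift s (single e a) = single (shift_exp e) (s a)"
proof -
  interpret cring_hom s by fact
  show ?thesis
    unfolding dshift_eq_lift by (subst monoid_ring_lift_single) (simp_all add: hom_zero mult_single)
qed

lemma dshift_dconst:
  assumes "cring_hom s"
  shows "dshift s (dconst a) = dconst (s a)"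
  by (simp add: dshift_single[OF assms] shift_exp_0)

lemma dshift_pvar:
  assumes "cring_hom s"
  shows "dshift s (pvar (v, k)) = pvar (v, Suc k)"
proof -
  interpret cring_hom s by fact
  show ?thesis
    by (simp add: dshift_single[OF assms] shift_exp_single hom_one)
qed

lemma funpow_commute:
  assumes "\<And>x. h (s x) = s' (h x)"
  shows "h ((s ^^ k) x) = (s' ^^ k) (h x)"
  by (induction k) (simp_all add: assms)

lemma pvar_eq_funpow_dshift:
  assumes "cring_hom s"
  shows "pvar (v, k) = (dshift s ^^ k) (dvar v)"
proof (induction k)
  case (Suc k)
  show ?case using dshift_pvar[OF assms, of v k] Suc.IH by simp
qed (simp add: dvar_def)

lemma deval_eq_lift:
  "deval s c g =
    monoid_ring_lift c (\<lambda>e. \<Prod>x\<in>keys e. ((s ^^ snd x) (g (fst x))) ^ lookup e x)"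
  by (rule ext) (simp add: deval_def monoid_ring_lift_def case_prod_unfold)

lemma cring_hom_deval:
  fixes g :: "'v \<Rightarrow> 'b::comm_ring_1"
  assumes "cring_hom c"
  shows "cring_hom (deval s c g)"
  unfolding deval_eq_lift
proof (rule cring_hom_monoid_ring_lift[OF assms])
  fix a b :: "'v \<times> nat \<Rightarrow>\<^sub>0 nat"
  let ?g = "\<lambda>x. (s ^^ snd x) (g (fst x))"
  let ?X = "keys a \<union> keys b"
  have mon: "(\<Prod>x\<in>keys e. ?g x ^ lookup e x) = (\<Prod>x\<in>?X. ?g x ^ lookup e x)" if "keys e \<subseteq> ?X" for e :: "'v \<times> nat \<Rightarrow>\<^sub>0 nat"
    using that by (intro prod.mono_neutral_left) (auto simp: in_keys_iff)
  show "(\<Prod>x\<in>keys (a + b). ?g x ^ lookup (a + b) x) =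
      (\<Prod>x\<in>keys a. ?g x ^ lookup a x) * (\<Prod>x\<in>keys b. ?g x ^ lookup b x)"
    unfolding mon[OF keys_add] mon[OF Un_upper1] mon[OF Un_upper2]
    by (simp add: lookup_add power_add prod.distrib)
qed simp

lemma deval_dconst:
  assumes "cring_hom c"
  shows "deval s c g (dconst a) = c a"
proof -
  interpret cring_hom c by fact
  show ?thesis unfolding deval_eq_lift by (simp add: monoid_ring_lift_single hom_zero)
qed

lemma deval_pvar:
  assumes "cring_hom c"
  shows "deval s c g (pvar (v, k)) = (s ^^ k) (g v)"
proof -
  interpret cring_hom c by fact
  show ?thesis unfolding deval_eq_lift by (simp add: monoid_ring_lift_single hom_zero hom_one)
qed

lemma deval_dvar:
  assumes "cring_hom c"
  shows "deval s c g (dvar v) = g v"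
  using deval_pvar[OF assms, of s g v 0] by (simp add: dvar_def)

lemma deval_dshift:
  assumes s: "cring_hom s" and c: "cring_hom c" and t: "cring_hom t" and "\<And>a. c (t a) = s (c a)"
  shows "deval s c g (dshift t f) = s (deval s c g f)"
proof (rule cring_hom_eqI_vars[of "\<lambda>f. deval s c g (dshift t f)" "\<lambda>f. s (deval s c g f)"])
  show "cring_hom (\<lambda>f. deval s c g (dshift t f))" "cring_hom (\<lambda>f. s (deval s c g f))"
    by (rule cring_hom_comp[OF cring_hom_deval[OF c] cring_hom_dshift[OF t]],
        rule cring_hom_comp[OF s cring_hom_deval[OF c]])
  show "deval s c g (dshift t (dconst a)) = s (deval s c g (dconst a))" for a
    by (simp add: dshift_dconst[OF t] deval_dconst[OF c] assms(4))
  show "deval s c g (dshift t (pvar x)) = s (deval s c g (pvar x))" for x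
    by (cases x) (simp only: dshift_pvar[OF t] deval_pvar[OF c] funpow.simps o_def)
qed

lemma map_eq_lift:
  assumes "cring_hom h"
  shows "Poly_Mapping.map h = monoid_ring_lift (\<lambda>a. single 0 (h a)) (\<lambda>e. single e 1)"
proof (rule ext)
  interpret cring_hom h by fact
  fix f
  have "monoid_ring_lift (\<lambda>a. single 0 (h a)) (\<lambda>e. single e 1) f = (\<Sum>e\<in>keys f. single e (h (lookup f e)))"
    by (simp add: monoid_ring_lift_def mult_single)
  moreover have "lookup (Poly_Mapping.map h f) k = (\<Sum>e\<in>keys f. if e = k then h (lookup f e) else 0)" for k
    by (auto simp: Poly_Mapping.map.rep_eq when_def in_keys_iff)
  ultimately show "Poly_Mapping.map h f = monoid_ring_lift (\<lambda>a. single 0 (h a)) (\<lambda>e. single e 1) f"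
    by (intro poly_mapping_eqI) (simp add: lookup_sum lookup_single when_def)
qed

lemma cring_hom_map:
  assumes "cring_hom h"
  shows "cring_hom (Poly_Mapping.map h :: ('e::comm_monoid_add \<Rightarrow>\<^sub>0 'a::comm_ring_1) \<Rightarrow> ('e \<Rightarrow>\<^sub>0 'b::comm_ring_1))"
  unfolding map_eq_lift[OF assms]
  by (intro cring_hom_monoid_ring_lift cring_hom_comp[OF cring_hom_dconst assms])
    (simp_all add: mult_single)

lemma map_hom_single:
  assumes "cring_hom h"
  shows "Poly_Mapping.map h (single e a) = single e (h a)"
proof -
  interpret cring_hom h by fact
  show ?thesis by (rule map_single) (rule hom_zero)
qed

lemma lookup_map_hom:
  assumes "cring_hom h"
  shows "lookup (Poly_Mapping.map h f) e = h (lookup f e)"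
proof -
  interpret cring_hom h by fact
  show ?thesis by (simp add: Poly_Mapping.map.rep_eq when_def hom_zero)
qed

lemma map_dshift:
  assumes h: "cring_hom h" and s: "cring_hom s" and t: "cring_hom t" and "\<And>a. h (s a) = t (h a)"
  shows "Poly_Mapping.map h (dshift s f) = dshift t (Poly_Mapping.map h f)"
proof (rule cring_hom_eqI_monomials[of "\<lambda>f. Poly_Mapping.map h (dshift s f)" "\<lambda>f. dshift t (Poly_Mapping.map h f)"])
  show "cring_hom (\<lambda>f. Poly_Mapping.map h (dshift s f))" "cring_hom (\<lambda>f. dshift t (Poly_Mapping.map h f))"
    by (rule cring_hom_comp[OF cring_hom_map[OF h] cring_hom_dshift[OF s]],
        rule cring_hom_comp[OF cring_hom_dshift[OF t] cring_hom_map[OF h]])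
  show "Poly_Mapping.map h (dshift s (single e a)) = dshift t (Poly_Mapping.map h (single e a))" for e a
    by (simp add: dshift_single[OF s] dshift_single[OF t] map_hom_single[OF h] assms(4))
  then show "Poly_Mapping.map h (dshift s (single e 1)) = dshift t (Poly_Mapping.map h (single e 1))" for e .
qed

lemma is_sigma_ideal_sigma_ideal: "is_sigma_ideal s (sigma_ideal s S)"
  by (auto simp: sigma_ideal_def is_sigma_ideal_def image_subset_iff)

lemma sigma_ideal_superset: "S \<subseteq> sigma_ideal s S"
  unfolding sigma_ideal_def by blast

lemma sigma_ideal_least: "is_sigma_ideal s I \<Longrightarrow> S \<subseteq> I \<Longrightarrow> sigma_ideal s S \<subseteq> I"
  unfolding sigma_ideal_def by blast

lemma
  assumes "is_sigma_ideal s I"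
  shows sigma_ideal_0: "0 \<in> I"
    and sigma_ideal_add: "a \<in> I \<Longrightarrow> b \<in> I \<Longrightarrow> a + b \<in> I"
    and sigma_ideal_mult: "a \<in> I \<Longrightarrow> c * a \<in> I"
    and sigma_ideal_shift: "a \<in> I \<Longrightarrow> s a \<in> I"
  using assms by (auto simp: is_sigma_ideal_def)

lemma sigma_ideal_diff:
  assumes "is_sigma_ideal s I" "a \<in> I" "b \<in> I"
  shows "a - b \<in> I"
  using sigma_ideal_add[OF assms(1,2) sigma_ideal_mult[OF assms(1,3), of "- 1"]] by simp

lemma sigma_ideal_sum:
  assumes "is_sigma_ideal s I" "\<And>x. x \<in> A \<Longrightarrow> f x \<in> I"
  shows "sum f A \<in> I"
  using assms(2)
  by (induction A rule: infinite_finite_induct)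
    (auto intro: sigma_ideal_0[OF assms(1)] sigma_ideal_add[OF assms(1)])

lemma sigma_ideal_funpow:
  assumes "is_sigma_ideal s I" "a \<in> I"
  shows "(s ^^ k) a \<in> I"
  by (induction k) (auto intro: assms(2) sigma_ideal_shift[OF assms(1)])

lemma is_sigma_ideal_vimage:
  assumes "cring_hom h" "\<And>x. h (s x) = t (h x)" "is_sigma_ideal t I"
  shows "is_sigma_ideal s {x. h x \<in> I}"
proof -
  interpret cring_hom h by fact
  show ?thesis
    using assms(3) unfolding is_sigma_ideal_def by (auto simp: hom_zero hom_add hom_mult assms(2))
qed

lemma is_sigma_ideal_zero:
  assumes "cring_hom s"
  shows "is_sigma_ideal s {0}"
proof -
  interpret cring_hom s by fact
  show ?thesis by (simp add: is_sigma_ideal_def hom_zero)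
qed

section \<open>The two elimination ideals coincide\<close>

lemma t_monomial_eq_single:
  "t_monomial \<beta> = single (\<Sum>j\<in>UNIV. \<Sum>k\<le>degree (\<beta> $ j).
    single (j, k) (coeff (\<beta> $ j) k)) 1"
  by (simp add: t_monomial_def prod_single)

lemma map_dconst_t_monomial: "Poly_Mapping.map dconst (t_monomial \<beta>) = t_monomial \<beta>"
  by (simp add: t_monomial_eq_single map_hom_single[OF cring_hom_dconst])

lemma lookup_dconst_mult:
  fixes f :: "'e::comm_monoid_add \<Rightarrow>\<^sub>0 'a::comm_ring_1"
  shows "lookup (single 0 a * f) e = a * lookup f e"
  by (simp flip: mult_map_scale_conv_mult add: Poly_Mapping.map.rep_eq when_def)

lemma cring_hom_shift_id: "cring_hom (dshift (id :: rat \<Rightarrow> rat))"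
  by (intro cring_hom_dshift cring_hom_id)

lemma cring_hom_shift2: "cring_hom (dshift (dshift (id :: rat \<Rightarrow> rat)))"
  by (intro cring_hom_dshift cring_hom_id)

lemma cring_hom_dconst2:
  "cring_hom (\<lambda>a :: 'a::comm_ring_1. single 0 (single 0 a) ::
    'd::comm_monoid_add \<Rightarrow>\<^sub>0 'e::comm_monoid_add \<Rightarrow>\<^sub>0 'a)"
  by (rule cring_hom_comp[OF cring_hom_dconst cring_hom_dconst])

lemma shift2_dconst: "dshift (dshift (id :: rat \<Rightarrow> rat)) (dconst f) = dconst (dshift id f)"
  by (rule dshift_dconst[OF cring_hom_shift_id])

lemma shift2_dconst2: "dshift (dshift (id :: rat \<Rightarrow> rat)) (dconst (dconst a)) = dconst (dconst a)"
  by (simp add: shift2_dconst dshift_dconst[OF cring_hom_id])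

definition toric_hom ::
  "('n::finite \<Rightarrow> int poly ^ 'm::finite) \<Rightarrow> ('n, ('u, rat) dpoly) dpoly \<Rightarrow> ('m, ('u, rat) dpoly) laurent_dpoly"
  where "toric_hom \<alpha> = deval (dshift (dshift id)) dconst (\<lambda>j. t_monomial (\<alpha> j))"

lemma cring_hom_toric_hom: "cring_hom (toric_hom \<alpha>)"
  unfolding toric_hom_def by (intro cring_hom_deval cring_hom_dconst)

interpretation toric_hom: cring_hom "toric_hom \<alpha>" for \<alpha>
  by (rule cring_hom_toric_hom)

lemma toric_hom_dconst: "toric_hom \<alpha> (dconst f) = dconst f"
  unfolding toric_hom_def by (rule deval_dconst[OF cring_hom_dconst])

lemma toric_hom_dvar: "toric_hom \<alpha> (dvar j) = t_monomial (\<alpha> j)"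
  unfolding toric_hom_def by (rule deval_dvar[OF cring_hom_dconst])

lemma toric_hom_shift: "toric_hom \<alpha> (dshift (dshift id) f) = dshift (dshift id) (toric_hom \<alpha> f)"
  unfolding toric_hom_def
  by (rule deval_dshift[OF cring_hom_shift2 cring_hom_dconst cring_hom_shift_id])
    (simp add: shift2_dconst)

lemma toric_hom_map_dconst:
  fixes \<alpha> :: "'n::finite \<Rightarrow> int poly ^ 'm::finite"
  shows "toric_hom \<alpha> (Poly_Mapping.map dconst f) =
    Poly_Mapping.map dconst (deval (dshift id) dconst (\<lambda>j. t_monomial (\<alpha> j)) f)"
proof (rule cring_hom_eqI_vars[of "\<lambda>f. toric_hom \<alpha> (Poly_Mapping.map dconst f)"
      "\<lambda>f. Poly_Mapping.map dconst (deval (dshift id) dconst (\<lambda>j. t_monomial (\<alpha> j)) f)"])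
  show "cring_hom (\<lambda>f. toric_hom \<alpha> (Poly_Mapping.map dconst f))"
    by (rule cring_hom_comp[OF cring_hom_toric_hom cring_hom_map[OF cring_hom_dconst]])
  show "cring_hom (\<lambda>f. Poly_Mapping.map dconst (deval (dshift id) dconst (\<lambda>j. t_monomial (\<alpha> j)) f))"
    by (rule cring_hom_comp[OF cring_hom_map[OF cring_hom_dconst] cring_hom_deval[OF cring_hom_dconst]])
  show "toric_hom \<alpha> (Poly_Mapping.map dconst (dconst a)) =
      Poly_Mapping.map dconst (deval (dshift id) dconst (\<lambda>j. t_monomial (\<alpha> j)) (dconst a))" for a
    by (simp add: map_hom_single[OF cring_hom_dconst] toric_hom_dconst deval_dconst[OF cring_hom_dconst])
  show "toric_hom \<alpha> (Poly_Mapping.map dconst (pvar x)) =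
      Poly_Mapping.map dconst (deval (dshift id) dconst (\<lambda>j. t_monomial (\<alpha> j)) (pvar x))" for x
  proof (cases x)
    case (Pair v k)
    have shift: "Poly_Mapping.map dconst (dshift id f) = dshift (dshift id) (Poly_Mapping.map dconst f)"
      for f :: "('m, rat) laurent_dpoly"
      by (rule map_dshift[OF cring_hom_dconst cring_hom_id cring_hom_shift_id])
        (simp add: dshift_dconst[OF cring_hom_id])
    have "toric_hom \<alpha> (Poly_Mapping.map dconst (pvar x)) = toric_hom \<alpha> (pvar x)"
      by (simp only: map_hom_single[OF cring_hom_dconst] single_one)
    also have "\<dots> = (dshift (dshift id) ^^ k) (t_monomial (\<alpha> v))"
      unfolding toric_hom_def Pair by (rule deval_pvar[OF cring_hom_dconst])
    also have "\<dots> = Poly_Mapping.map dconst ((dshift id ^^ k) (t_monomial (\<alpha> v)))"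
      by (subst funpow_commute[of "Poly_Mapping.map dconst" "dshift id" "dshift (dshift id)", OF shift]) (simp only: map_dconst_t_monomial)
    finally show ?thesis
      unfolding Pair by (simp only: deval_pvar[OF cring_hom_dconst])
  qed
qed

lemma toric_hom_hyperplane: "toric_hom \<alpha> (generic_hyperplane i) = sparse_P \<alpha> i"
  by (simp add: generic_hyperplane_def sparse_P_def toric_hom.hom_add toric_hom.hom_sum
      toric_hom.hom_mult toric_hom_dconst toric_hom_dvar)

subsection \<open>The kernel of the toric homomorphism\<close>

lemma lookup_sum_monomials:
  fixes H :: "'d::comm_monoid_add \<Rightarrow> ('e::comm_monoid_add \<Rightarrow>\<^sub>0 'a::comm_ring_1)"
  shows "lookup (\<Sum>d\<in>D. single 0 (single d 1) * Poly_Mapping.map (single 0) (H d)) e = (\<Sum>d\<in>D. single d (lookup (H d) e))"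
  by (simp add: lookup_sum lookup_dconst_mult mult_single lookup_map_hom[OF cring_hom_dconst])

text \<open>
  Coefficients in \<open>\<rat>{U}\<close> add nothing essential to the kernel: \<open>\<rat>{U}\<close> is free over
  \<open>\<rat>\<close> on its monomials, the homomorphism respects the resulting decomposition, and the
  components of an element of the kernel lie in the toric ideal.
\<close>

lemma toric_hom_kernel:
  assumes I: "is_sigma_ideal s I" "Poly_Mapping.map dconst ` toric_ideal \<alpha> \<subseteq> I"
    and g: "toric_hom \<alpha> g = 0"
  shows "g \<in> I"
proof -
  define D where "D = (\<Union>e\<in>keys g. keys (lookup g e))"
  have fin: "finite D" by (simp add: D_def)
  define H where "H d = Poly_Mapping.map (\<lambda>a. lookup a d) g" for d
  have lookup_H: "lookup (H d) e = lookup (lookup g e) d" for d e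
    by (simp add: H_def Poly_Mapping.map.rep_eq when_def)
  have g_eq: "g = (\<Sum>d\<in>D. dconst (single d 1) * Poly_Mapping.map dconst (H d))"
  proof (rule poly_mapping_eqI)
    fix e
    have "lookup g e = (\<Sum>d\<in>keys (lookup g e). single d (lookup (lookup g e) d))"
      by (rule poly_mapping_sum_single)
    also have "\<dots> = (\<Sum>d\<in>D. single d (lookup (lookup g e) d))"
      using fin unfolding D_def
      by (intro sum.mono_neutral_left) (force simp: in_keys_iff)+
    finally show "lookup g e = lookup (\<Sum>d\<in>D. dconst (single d 1) * Poly_Mapping.map dconst (H d)) e"
      by (simp only: lookup_sum_monomials lookup_H)
  qed
  let ?\<phi> = "deval (dshift id) dconst (\<lambda>j. t_monomial (\<alpha> j))"
  have "toric_hom \<alpha> g = (\<Sum>d\<in>D. dconst (single d 1) * Poly_Mapping.map dconst (?\<phi> (H d)))"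
    by (subst g_eq) (simp only: toric_hom.hom_sum toric_hom.hom_mult toric_hom_dconst toric_hom_map_dconst)
  then have zero: "(\<Sum>d\<in>D. single d (lookup (?\<phi> (H d)) e)) = 0" for e
    using g lookup_sum_monomials[where D = D and H = "\<lambda>d. ?\<phi> (H d)" and e = e] by simp
  have "?\<phi> (H d) = 0" if "d \<in> D" for d
  proof (rule poly_mapping_eqI)
    fix e
    have "lookup (?\<phi> (H d)) e = lookup (\<Sum>d\<in>D. single d (lookup (?\<phi> (H d)) e)) d"
      using fin that by (simp add: lookup_sum lookup_single when_def)
    then show "lookup (?\<phi> (H d)) e = lookup 0 e" by (simp add: zero)
  qed
  then have "Poly_Mapping.map dconst (H d) \<in> I" if "d \<in> D" for d
    using I(2) that by (auto simp: toric_ideal_def)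
  then show "g \<in> I"
    by (subst g_eq) (intro sigma_ideal_sum[OF I(1)] sigma_ideal_mult[OF I(1)])
qed

subsection \<open>Solving for the free coefficients\<close>

text \<open>
  The equations \<open>u\<^sub>i\<^sub>0 + \<Sum>\<^sub>j u\<^sub>i\<^sub>j M\<^sub>j = 0\<close> are linear in the \<open>u\<^sub>i\<^sub>0\<close>. Modulo the
  \<open>\<sigma>\<close>-ideal that they generate, a polynomial in the \<open>u\<^sub>i\<^sub>j\<close> is therefore equal to the one
  where the solution \<open>u\<^sub>i\<^sub>0 = - \<Sum>\<^sub>j u\<^sub>i\<^sub>j M\<^sub>j\<close> is substituted.
\<close>

definition solution ::
  "('n::finite \<Rightarrow> ('v \<times> nat \<Rightarrow>\<^sub>0 'e::comm_monoid_add) \<Rightarrow>\<^sub>0 ('m, 'n) upoly) \<Rightarrow> 'm option \<times> 'n option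
    \<Rightarrow> ('v \<times> nat \<Rightarrow>\<^sub>0 'e) \<Rightarrow>\<^sub>0 ('m, 'n) upoly" where
  "solution M u = (case u of
      (i, None) \<Rightarrow> - (\<Sum>j\<in>UNIV. dconst (dvar (i, Some j)) * M j)
    | (i, Some j) \<Rightarrow> dconst (dvar (i, Some j)))"

definition substitute_solution ::
  "('n::finite \<Rightarrow> ('v \<times> nat \<Rightarrow>\<^sub>0 'e::comm_monoid_add) \<Rightarrow>\<^sub>0 ('m, 'n) upoly) \<Rightarrow> ('m, 'n) upoly
    \<Rightarrow> ('v \<times> nat \<Rightarrow>\<^sub>0 'e) \<Rightarrow>\<^sub>0 ('m, 'n) upoly" where
  "substitute_solution M = deval (dshift (dshift id)) (\<lambda>a. dconst (dconst a)) (solution M)"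

lemma cring_hom_substitute_solution: "cring_hom (substitute_solution M)"
  unfolding substitute_solution_def by (intro cring_hom_deval cring_hom_dconst2)

interpretation substitute_solution: cring_hom "substitute_solution M" for M
  by (rule cring_hom_substitute_solution)

lemma substitute_solution_dvar: "substitute_solution M (dvar u) = solution M u"
  unfolding substitute_solution_def by (rule deval_dvar[OF cring_hom_dconst2])

lemma substitute_solution_pvar:
  "substitute_solution M (pvar (u, k)) = (dshift (dshift id) ^^ k) (solution M u)"
  unfolding substitute_solution_def by (rule deval_pvar[OF cring_hom_dconst2])

lemma substitute_solution_dconst: "substitute_solution M (dconst a) = dconst (dconst a)"
  unfolding substitute_solution_def by (rule deval_dconst[OF cring_hom_dconst2])

lemma substitute_solution_shift:
  "substitute_solution M (dshift id f) = dshift (dshift id) (substitute_solution M f)"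
  unfolding substitute_solution_def
  by (rule deval_dshift[OF cring_hom_shift2 cring_hom_dconst2 cring_hom_id])
    (simp add: shift2_dconst2)

lemma toric_hom_substitute_solution:
  "toric_hom \<alpha> (substitute_solution dvar f) = substitute_solution (\<lambda>j. t_monomial (\<alpha> j)) f"
proof (rule cring_hom_eqI_vars[of "\<lambda>f. toric_hom \<alpha> (substitute_solution dvar f)"
      "substitute_solution (\<lambda>j. t_monomial (\<alpha> j))"])
  show "cring_hom (\<lambda>f. toric_hom \<alpha> (substitute_solution dvar f))"
    by (rule cring_hom_comp[OF cring_hom_toric_hom cring_hom_substitute_solution])
  show "cring_hom (substitute_solution (\<lambda>j. t_monomial (\<alpha> j)))"
    by (rule cring_hom_substitute_solution)
  show "toric_hom \<alpha> (substitute_solution dvar (dconst a)) =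
      substitute_solution (\<lambda>j. t_monomial (\<alpha> j)) (dconst a)" for a
    by (simp add: substitute_solution_dconst toric_hom_dconst)
  have sol: "toric_hom \<alpha> (solution dvar u) = solution (\<lambda>j. t_monomial (\<alpha> j)) u" for u
    by (simp add: solution_def toric_hom.hom_uminus toric_hom.hom_sum toric_hom.hom_mult
        toric_hom_dconst toric_hom_dvar split: prod.split option.split)
  show "toric_hom \<alpha> (substitute_solution dvar (pvar x)) =
      substitute_solution (\<lambda>j. t_monomial (\<alpha> j)) (pvar x)" for x
    by (cases x) (simp only: substitute_solution_pvar
        funpow_commute[of "toric_hom \<alpha>" "dshift (dshift id)" "dshift (dshift id)",
          OF toric_hom_shift] sol)
qed

text \<open>
  Applied to the coefficients in \<open>\<rat>{U}\<close> and fixing the variables \<open>T\<close>, the substitution is a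
  \<open>\<sigma>\<close>-homomorphism that kills every \<open>P\<^sub>i\<close>, hence the \<open>\<sigma>\<close>-ideal that they generate.
\<close>

lemma substitute_solution_resultant_ideal:
  fixes \<alpha> :: "'n::finite \<Rightarrow> int poly ^ 'm::finite"
  assumes "f \<in> resultant_ideal \<alpha>"
  shows "substitute_solution (\<lambda>j. t_monomial (\<alpha> j)) f = 0"
proof -
  let ?\<sigma> = "dshift (dshift id)" and ?M = "\<lambda>j. t_monomial (\<alpha> j)"
  define \<Theta> :: "('m, ('m, 'n) upoly) laurent_dpoly \<Rightarrow> ('m, ('m, 'n) upoly) laurent_dpoly"
    where "\<Theta> = monoid_ring_lift (substitute_solution ?M) (\<lambda>e. single e 1)"
  have hom: "cring_hom \<Theta>"
    unfolding \<Theta>_def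
    by (rule cring_hom_monoid_ring_lift[OF cring_hom_substitute_solution]) (simp_all add: mult_single)
  then interpret \<Theta>: cring_hom \<Theta> .
  have single: "\<Theta> (single e a) = substitute_solution ?M a * single e 1" for e a
    unfolding \<Theta>_def by (rule monoid_ring_lift_single) (rule substitute_solution.hom_zero)
  have shift: "\<Theta> (?\<sigma> g) = ?\<sigma> (\<Theta> g)" for g
  proof (rule cring_hom_eqI_monomials[of "\<lambda>g. \<Theta> (?\<sigma> g)" "\<lambda>g. ?\<sigma> (\<Theta> g)"])
    show "cring_hom (\<lambda>g. \<Theta> (?\<sigma> g))" "cring_hom (\<lambda>g. ?\<sigma> (\<Theta> g))"
      by (rule cring_hom_comp[OF hom cring_hom_shift2], rule cring_hom_comp[OF cring_hom_shift2 hom])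
    interpret \<sigma>\<^sub>0: cring_hom "dshift id :: ('m, 'n) upoly \<Rightarrow> _"
      by (rule cring_hom_shift_id)
    show "\<Theta> (?\<sigma> (dconst a)) = ?\<sigma> (\<Theta> (dconst a))" for a
      by (simp add: shift2_dconst single substitute_solution_shift)
    show "\<Theta> (?\<sigma> (single e 1)) = ?\<sigma> (\<Theta> (single e 1))" for e
      by (simp add: dshift_single[OF cring_hom_shift_id] single \<sigma>\<^sub>0.hom_one substitute_solution.hom_one)
  qed
  have "\<Theta> (sparse_P \<alpha> i) = 0" for i
    by (simp add: sparse_P_def \<Theta>.hom_add \<Theta>.hom_sum \<Theta>.hom_mult single substitute_solution_dvar
        solution_def t_monomial_eq_single substitute_solution.hom_one)
  moreover have "is_sigma_ideal ?\<sigma> {g. \<Theta> g \<in> {0}}"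
    by (rule is_sigma_ideal_vimage[where h = \<Theta> and s = "?\<sigma>" and t = "?\<sigma>",
          OF hom shift is_sigma_ideal_zero[OF cring_hom_shift2]])
  ultimately have "sigma_ideal ?\<sigma> (range (sparse_P \<alpha>)) \<subseteq> {g. \<Theta> g \<in> {0}}"
    by (intro sigma_ideal_least) auto
  then have "\<Theta> (dconst f) = 0" using assms by (auto simp: resultant_ideal_def)
  then show ?thesis by (simp add: single)
qed

text \<open>
  The polynomials that agree with their substituted form modulo \<open>I\<close> form a \<open>\<sigma>\<close>-subring, and
  the only generators that the substitution changes are the \<open>u\<^sub>i\<^sub>0\<close>, by \<open>L\<^sub>i\<close>.
\<close>

lemma dconst_minus_substitute_solution:
  fixes f :: "('m::finite, 'n::finite) upoly"
  assumes I: "is_sigma_ideal (dshift (dshift id)) I" "range generic_hyperplane \<subseteq> I"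
  shows "dconst f - substitute_solution dvar f \<in> I"
proof (induction f rule: pvar_induct)
  case (const a)
  show ?case by (simp add: substitute_solution_dconst sigma_ideal_0[OF I(1)])
next
  case (var x)
  obtain i j k where x: "x = ((i, j), k)" by (metis prod.exhaust)
  let ?\<sigma> = "dshift (dshift id) :: ('n, ('m, 'n) upoly) dpoly \<Rightarrow> ('n, ('m, 'n) upoly) dpoly"
  interpret \<sigma>k: cring_hom "?\<sigma> ^^ k"
    by (rule cring_hom_funpow[OF cring_hom_shift2])
  have "dconst (dvar (i, j)) - solution dvar (i, j) \<in> I"
    using I(2) sigma_ideal_0[OF I(1)]
    by (cases j) (auto simp: solution_def generic_hyperplane_def image_subset_iff)
  then have "(?\<sigma> ^^ k) (dconst (dvar (i, j)) - solution dvar (i, j)) \<in> I"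
    by (rule sigma_ideal_funpow[OF I(1)])
  moreover have "dconst (pvar x) = (?\<sigma> ^^ k) (dconst (dvar (i, j)))"
    unfolding x pvar_eq_funpow_dshift[OF cring_hom_id]
    by (rule funpow_commute[of dconst]) (simp add: shift2_dconst)
  ultimately show ?case
    unfolding x substitute_solution_pvar by (simp only: \<sigma>k.hom_diff)
next
  case (add f g)
  then show ?case
    using sigma_ideal_add[OF I(1) add.IH]
    by (simp add: single_add substitute_solution.hom_add algebra_simps)
next
  case (mult f g)
  have "dconst f * (dconst g - substitute_solution dvar g)
      + substitute_solution dvar g * (dconst f - substitute_solution dvar f) \<in> I"
    by (intro sigma_ideal_add[OF I(1)] sigma_ideal_mult[OF I(1)] mult.IH)
  then show ?case
    by (simp add: substitute_solution.hom_mult cring_hom.hom_mult[OF cring_hom_dconst] algebra_simps)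
qed

theorem chow_ideal_toric_ideal:
  fixes \<alpha> :: "'n::finite \<Rightarrow> int poly ^ 'm::finite"
  shows "chow_ideal (toric_ideal \<alpha>) = resultant_ideal \<alpha>"
proof (intro equalityI subsetI)
  let ?\<sigma> = "dshift (dshift id)"
  fix f :: "('m, 'n) upoly" assume f: "f \<in> chow_ideal (toric_ideal \<alpha>)"
  let ?P = "sigma_ideal ?\<sigma> (range (sparse_P \<alpha>))"
  note P = is_sigma_ideal_sigma_ideal[of ?\<sigma> "range (sparse_P \<alpha>)"]
  have "toric_hom \<alpha> (Poly_Mapping.map dconst h) \<in> ?P" if "h \<in> toric_ideal \<alpha>" for h
    using that sigma_ideal_0[OF P] 
    by (simp add: toric_hom_map_dconst toric_ideal_def cring_hom.hom_zero[OF cring_hom_map[OF cring_hom_dconst]])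
  moreover have "toric_hom \<alpha> (generic_hyperplane i) \<in> ?P" for i
    unfolding toric_hom_hyperplane by (rule subsetD[OF sigma_ideal_superset rangeI])
  moreover have "is_sigma_ideal ?\<sigma> {g. toric_hom \<alpha> g \<in> ?P}"
    by (rule is_sigma_ideal_vimage[where h = "toric_hom \<alpha>" and s = "?\<sigma>" and t = "?\<sigma>",
          OF cring_hom_toric_hom toric_hom_shift P])
  ultimately have "sigma_ideal ?\<sigma> (Poly_Mapping.map dconst ` toric_ideal \<alpha> \<union> range generic_hyperplane)
      \<subseteq> {g. toric_hom \<alpha> g \<in> ?P}"
    by (intro sigma_ideal_least) auto
  then have "toric_hom \<alpha> (dconst f) \<in> ?P" using f by (auto simp: chow_ideal_def)
  then show "f \<in> resultant_ideal \<alpha>" by (simp add: toric_hom_dconst resultant_ideal_def)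
next
  let ?\<sigma> = "dshift (dshift id)"
  fix f :: "('m, 'n) upoly" assume f: "f \<in> resultant_ideal \<alpha>"
  let ?G = "Poly_Mapping.map dconst ` toric_ideal \<alpha> \<union> range generic_hyperplane"
  let ?J = "sigma_ideal ?\<sigma> ?G"
  note J = is_sigma_ideal_sigma_ideal[of ?\<sigma> ?G]
  have gens: "Poly_Mapping.map dconst ` toric_ideal \<alpha> \<subseteq> ?J" "range generic_hyperplane \<subseteq> ?J"
    using sigma_ideal_superset[of ?G ?\<sigma>] by blast+
  have "toric_hom \<alpha> (substitute_solution dvar f) = 0"
    using f by (simp only: toric_hom_substitute_solution substitute_solution_resultant_ideal)
  then have "substitute_solution dvar f \<in> ?J"
    by (rule toric_hom_kernel[OF J gens(1)])
  with dconst_minus_substitute_solution[OF J gens(2), of f]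
  have "(dconst f - substitute_solution dvar f) + substitute_solution dvar f \<in> ?J"
    by (rule sigma_ideal_add[OF J])
  then show "f \<in> chow_ideal (toric_ideal \<alpha>)" by (simp add: chow_ideal_def)
qed

lemma chow_ideal_diff: "f \<in> chow_ideal I \<Longrightarrow> g \<in> chow_ideal I \<Longrightarrow> f - g \<in> chow_ideal I"
  unfolding chow_ideal_def
  by (simp add: single_diff sigma_ideal_diff[OF is_sigma_ideal_sigma_ideal])

lemma chow_ideal_mult: "f \<in> chow_ideal I \<Longrightarrow> h * f \<in> chow_ideal I"
  unfolding chow_ideal_def
  by (simp add: cring_hom.hom_mult[OF cring_hom_dconst] sigma_ideal_mult[OF is_sigma_ideal_sigma_ideal])

theorem theorem6p31:
  fixes \<alpha> :: "'n::finite \<Rightarrow> int poly ^ 'm::finite"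
    and R C :: "('m, 'n) upoly"
  assumes "rank ((\<chi> j i. to_fract (\<alpha> i $ j)) :: int poly fract ^ 'n ^ 'm) = CARD('m)"
    and "is_sparse_resultant \<alpha> R"
    and "is_chow_form (toric_ideal \<alpha>) C"
  shows "R = C \<or> R = - C"
proof -
  obtain r where r: "ranking r" and C: "heads_characteristic_set r (chow_ideal (toric_ideal \<alpha>)) C"
      and "irreducible C" "primitive_integral C"
    using assms(3) unfolding is_chow_form_def by blast
  have R: "heads_characteristic_set r (chow_ideal (toric_ideal \<alpha>)) R"
      and "irreducible R" "primitive_integral R"
    using assms(2) r unfolding is_sparse_resultant_def chow_ideal_toric_ideal by blast+
  from r chow_ideal_diff chow_ideal_mult \<open>irreducible R\<close> \<open>primitive_integral R\<close> R
    \<open>irreducible C\<close> \<open>primitive_integral C\<close> C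
  show ?thesis by (rule heads_characteristic_set_unique)
qed

end
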